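(* For every infinite cardinal $\kappa$ there are $2^\kappa$ pairwise non-isomorphic (non-degenerate) open projective planes of cardinality $\kappa$.
   Context: A projective plane is a system of points and lines in which any two distinct points lie on exactly one common line and any two distinct lines meet in exactly one common point; non-degenerate means it contains four points no three of which are collinear. A projective plane $P$ is open if there is no finite subconfiguration (subset with induced incidence) $A$ of $P$ such that every element of $A$ is incident with at least three elements of $A$. *)

theory Defs
  imports Main
begin

unbundle cardinal_syntax

text \<open>
  Points and lines are two separate sorts, so an isomorphism maps points to points and
  lines to lines. Only the values of \<open>incident\<close> on \<open>points \<times> lines\<close> are relevant.
\<close>

record ('p, 'l) incidence_structure =
  points :: "'p set"
  lines :: "'l set"
  incident :: "'p \<Rightarrow> 'l \<Rightarrow> bool"

definition elements :: "('p, 'l) incidence_structure \<Rightarrow> ('p + 'l) set" where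
  "elements P = points P <+> lines P"

definition collinear_in :: "('p, 'l) incidence_structure \<Rightarrow> 'p set \<Rightarrow> bool" where
  "collinear_in P T \<longleftrightarrow> (\<exists>l\<in>lines P. \<forall>p\<in>T. incident P p l)"

definition projective_plane :: "('p, 'l) incidence_structure \<Rightarrow> bool" where
  "projective_plane P \<longleftrightarrow>
     (\<forall>p\<in>points P. \<forall>q\<in>points P. p \<noteq> q \<longrightarrow>
        (\<exists>!l. l \<in> lines P \<and> incident P p l \<and> incident P q l)) \<and>
     (\<forall>l\<in>lines P. \<forall>m\<in>lines P. l \<noteq> m \<longrightarrow>
        (\<exists>!p. p \<in> points P \<and> incident P p l \<and> incident P p m))"

definition nondegenerate :: "('p, 'l) incidence_structure \<Rightarrow> bool" where
  "nondegenerate P \<longleftrightarrow>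
     (\<exists>Q\<subseteq>points P. card Q = 4 \<and> (\<forall>T\<subseteq>Q. card T = 3 \<longrightarrow> \<not> collinear_in P T))"

text \<open>
  A finite subconfiguration is given by its set \<open>X\<close> of points and its set \<open>Y\<close> of lines.
  It has to be nonempty: the empty one satisfies the degree condition vacuously, so
  admitting it would leave no open structures at all.
\<close>

definition open_structure :: "('p, 'l) incidence_structure \<Rightarrow> bool" where
  "open_structure P \<longleftrightarrow>
     \<not> (\<exists>X Y. X \<subseteq> points P \<and> Y \<subseteq> lines P \<and> finite X \<and> finite Y \<and> (X \<noteq> {} \<or> Y \<noteq> {}) \<and>
          (\<forall>p\<in>X. 3 \<le> card {l \<in> Y. incident P p l}) \<and>
          (\<forall>l\<in>Y. 3 \<le> card {p \<in> X. incident P p l}))"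

definition isomorphic ::
  "('p, 'l) incidence_structure \<Rightarrow> ('q, 'm) incidence_structure \<Rightarrow> bool" where
  "isomorphic P P' \<longleftrightarrow>
     (\<exists>f g. bij_betw f (points P) (points P') \<and> bij_betw g (lines P) (lines P') \<and>
        (\<forall>p\<in>points P. \<forall>l\<in>lines P. incident P' (f p) (g l) \<longleftrightarrow> incident P p l))"

end

theory Submission
  imports Defs
begin

text \<open>
  Given \<open>S \<subseteq> \<kappa>\<close>, a partial plane codes the well-order \<open>\<kappa>\<close> together with \<open>S\<close>: there are points
  \<open>x\<^sub>a\<close> for \<open>a \<in> \<kappa>\<close>, lines \<open>y\<^sub>b\<close> for \<open>b \<in> \<kappa>\<close> and second copies \<open>y'\<^sub>b\<close> for \<open>b \<in> S\<close>, and whenever \<open>b \<le> a\<close>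
  an infinite chain of elements \<open>\<dots>, z\<^sub>2, z\<^sub>1, z\<^sub>0\<close> links \<open>x\<^sub>a\<close> to \<open>y\<^sub>b\<close>. Each element of the chain has exactly two
  neighbours among its predecessors and the finitely many ends of the chain, so the partial plane,
  and with it its free completion, is open. On the other hand every finite initial part
  \<open>z\<^sub>n, \<dots>, z\<^sub>0\<close> can be enlarged to a finite set in which only a fixed finite set of elements has degree
  below three. In the free completion a new element has only two neighbours that are not newer than
  itself, which confines such sets to the partial plane up to finitely many elements. Hence the pairs
  joined by such a chain are determined by the completion alone. The sets \<open>{x\<^sub>a | b \<le> a}\<close>
  and the number of lines defining each of them can therefore be read off, and by rigidity of
  well-orders they determine \<open>S\<close>.
\<close>

section \<open>Isomorphisms\<close>

lemma isomorphic_sym: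
  assumes "isomorphic P P'"
  shows "isomorphic P' P"
proof -
  obtain f g where f: "bij_betw f (points P) (points P')"
    and g: "bij_betw g (lines P) (lines P')"
    and i: "\<And>p l. p \<in> points P \<Longrightarrow> l \<in> lines P \<Longrightarrow> incident P' (f p) (g l) \<longleftrightarrow> incident P p l"
    using assms unfolding isomorphic_def by blast
  let ?f = "inv_into (points P) f" and ?g = "inv_into (lines P) g"
  have "incident P (?f p) (?g l) \<longleftrightarrow> incident P' p l" if "p \<in> points P'" "l \<in> lines P'" for p l
    using i[of "?f p" "?g l"] that f g
    by (simp add: bij_betw_def inv_into_into f_inv_into_f)
  then show ?thesis
    unfolding isomorphic_def using bij_betw_inv_into[OF f] bij_betw_inv_into[OF g] by blast
qed

lemma isomorphic_trans:
  assumes "isomorphic P P'" and "isomorphic P' P''"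
  shows "isomorphic P P''"
proof -
  obtain f g where f: "bij_betw f (points P) (points P')" "bij_betw g (lines P) (lines P')"
    and i: "\<forall>p\<in>points P. \<forall>l\<in>lines P. incident P' (f p) (g l) \<longleftrightarrow> incident P p l"
    using assms(1) unfolding isomorphic_def by blast
  obtain f' g' where f': "bij_betw f' (points P') (points P'')" "bij_betw g' (lines P') (lines P'')"
    and i': "\<forall>p\<in>points P'. \<forall>l\<in>lines P'. incident P'' (f' p) (g' l) \<longleftrightarrow> incident P' p l"
    using assms(2) unfolding isomorphic_def by blast
  have "\<forall>p\<in>points P. \<forall>l\<in>lines P. incident P'' ((f' \<circ> f) p) ((g' \<circ> g) l) \<longleftrightarrow> incident P p l"
    using i i' f by (simp add: bij_betw_apply)
  then show ?thesis
    unfolding isomorphic_def using bij_betw_trans[OF f(1) f'(1)] bij_betw_trans[OF f(2) f'(2)] by blast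
qed

text \<open>The family has to live in the type of the cardinal, while the free completion consists
  of terms, so planes are moved along an injection. \<open>h\<close> is inverted on points and on
  lines separately, each sort having its own domain.\<close>

definition relabel :: "('p \<Rightarrow> 'q) \<Rightarrow> ('p, 'p) incidence_structure \<Rightarrow> ('q, 'q) incidence_structure" where
  "relabel h P = \<lparr>points = h ` points P, lines = h ` lines P,
     incident = (\<lambda>p l. incident P (inv_into (points P) h p) (inv_into (lines P) h l))\<rparr>"

lemma isomorphic_relabel:
  assumes "inj_on h (points P)" and "inj_on h (lines P)"
  shows "isomorphic P (relabel h P)"
  unfolding isomorphic_def relabel_def
  by (rule exI[of _ h], rule exI[of _ h]) (use assms in \<open>auto simp: bij_betw_def\<close>)

lemma isomorphicE:
  assumes "isomorphic P P'"
  obtains f g where "inj_on f (points P)" "points P' = f ` points P"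
    "inj_on g (lines P)" "lines P' = g ` lines P"
    "\<And>p l. p \<in> points P \<Longrightarrow> l \<in> lines P \<Longrightarrow> incident P' (f p) (g l) \<longleftrightarrow> incident P p l"
proof -
  obtain f g where "bij_betw f (points P) (points P')" "bij_betw g (lines P) (lines P')"
    "\<forall>p\<in>points P. \<forall>l\<in>lines P. incident P' (f p) (g l) \<longleftrightarrow> incident P p l"
    using assms unfolding isomorphic_def by blast
  then show thesis by (intro that[of f g]) (simp_all add: bij_betw_def)
qed

lemma ex1_image:
  assumes "\<exists>!x. x \<in> X \<and> R x" and "\<And>x. x \<in> X \<Longrightarrow> R' (f x) \<longleftrightarrow> R x"
  shows "\<exists>!y. y \<in> f ` X \<and> R' y"
proof -
  obtain x where x: "x \<in> X" "R x" and u: "\<And>z. z \<in> X \<Longrightarrow> R z \<Longrightarrow> z = x"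
    using assms(1) by blast
  show ?thesis
  proof (rule ex1I[of _ "f x"])
    show "f x \<in> f ` X \<and> R' (f x)" using x assms(2) by blast
    show "y = f x" if "y \<in> f ` X \<and> R' y" for y using that u assms(2) by blast
  qed
qed

lemma card_image_Collect:
  assumes "inj_on f X" and "\<And>x. x \<in> X \<Longrightarrow> R' (f x) \<longleftrightarrow> R x"
  shows "card {y \<in> f ` X. R' y} = card {x \<in> X. R x}"
proof -
  have "{y \<in> f ` X. R' y} = f ` {x \<in> X. R x}" using assms(2) by blast
  moreover have "inj_on f {x \<in> X. R x}" using assms(1) by (rule inj_on_subset) blast
  ultimately show ?thesis by (simp add: card_image)
qed

lemma projective_plane_isomorphic:
  assumes "isomorphic P P'" and "projective_plane P"
  shows "projective_plane P'"
proof -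
  obtain f g where f: "inj_on f (points P)" "points P' = f ` points P"
    and g: "inj_on g (lines P)" "lines P' = g ` lines P"
    and i: "\<And>p l. p \<in> points P \<Longrightarrow> l \<in> lines P \<Longrightarrow> incident P' (f p) (g l) \<longleftrightarrow> incident P p l"
    by (rule isomorphicE[OF assms(1)]) (rule that)
  have 1: "\<exists>!l. l \<in> g ` lines P \<and> incident P' (f p) l \<and> incident P' (f q) l"
    if "p \<in> points P" "q \<in> points P" "f p \<noteq> f q" for p q
  proof (rule ex1_image)
    have "p \<noteq> q" using that(3) by blast
    then show "\<exists>!l. l \<in> lines P \<and> incident P p l \<and> incident P q l"
      using assms(2) that(1,2) by (simp add: projective_plane_def)
  qed (use i that in simp)
  have 2: "\<exists>!p. p \<in> f ` points P \<and> incident P' p (g l) \<and> incident P' p (g m)"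
    if "l \<in> lines P" "m \<in> lines P" "g l \<noteq> g m" for l m
  proof (rule ex1_image)
    have "l \<noteq> m" using that(3) by blast
    then show "\<exists>!p. p \<in> points P \<and> incident P p l \<and> incident P p m"
      using assms(2) that(1,2) by (simp add: projective_plane_def)
  qed (use i that in simp)
  show ?thesis
    unfolding projective_plane_def f(2) g(2)
    by (intro conjI ballI impI; elim imageE; hypsubst) (rule 1 2; assumption)+
qed

lemma nondegenerate_isomorphic:
  assumes "isomorphic P P'" and "nondegenerate P"
  shows "nondegenerate P'"
proof -
  obtain f g where f: "inj_on f (points P)" "points P' = f ` points P"
    and g: "inj_on g (lines P)" "lines P' = g ` lines P"
    and i: "\<And>p l. p \<in> points P \<Longrightarrow> l \<in> lines P \<Longrightarrow> incident P' (f p) (g l) \<longleftrightarrow> incident P p l"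
    by (rule isomorphicE[OF assms(1)]) (rule that)
  obtain Q where Q: "Q \<subseteq> points P" "card Q = 4"
    and nc: "\<And>T. T \<subseteq> Q \<Longrightarrow> card T = 3 \<Longrightarrow> \<not> collinear_in P T"
    using assms(2) unfolding nondegenerate_def by blast
  have inj: "inj_on f Q" using f(1) Q(1) by (rule inj_on_subset)
  have "\<not> collinear_in P' T'" if T': "T' \<subseteq> f ` Q" "card T' = 3" for T'
  proof
    obtain T where T: "T \<subseteq> Q" "T' = f ` T" using T'(1) by (rule subset_imageE)
    have "card T = 3" using T T'(2) card_image[OF inj_on_subset[OF inj T(1)]] by simp
    assume "collinear_in P' T'"
    then obtain l where l: "l \<in> lines P" "\<And>p. p \<in> T \<Longrightarrow> incident P' (f p) (g l)"
      unfolding collinear_in_def g(2) T(2) by auto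
    have "incident P p l" if "p \<in> T" for p
      using l(2)[OF that] i[OF _ l(1), of p] that T(1) Q(1) by auto
    then have "collinear_in P T" unfolding collinear_in_def using l(1) by blast
    then show False using nc T(1) \<open>card T = 3\<close> by blast
  qed
  moreover have "f ` Q \<subseteq> points P'" unfolding f(2) using Q(1) by (rule image_mono)
  moreover have "card (f ` Q) = 4" using card_image[OF inj] Q(2) by (rule trans)
  ultimately show ?thesis unfolding nondegenerate_def by (intro exI[of _ "f ` Q"]) simp
qed

lemma open_structure_isomorphic:
  assumes "isomorphic P P'" and "open_structure P"
  shows "open_structure P'"
proof -
  obtain f g where f: "inj_on f (points P')" "points P = f ` points P'"
    and g: "inj_on g (lines P')" "lines P = g ` lines P'"
    and i: "\<And>p l. p \<in> points P' \<Longrightarrow> l \<in> lines P' \<Longrightarrow> incident P (f p) (g l) \<longleftrightarrow> incident P' p l"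
    by (rule isomorphicE[OF isomorphic_sym[OF assms(1)]]) (rule that)
  have False if X: "X \<subseteq> points P'" "finite X" and Y: "Y \<subseteq> lines P'" "finite Y"
    and ne: "X \<noteq> {} \<or> Y \<noteq> {}"
    and dX: "\<forall>p\<in>X. 3 \<le> card {l \<in> Y. incident P' p l}"
    and dY: "\<forall>l\<in>Y. 3 \<le> card {p \<in> X. incident P' p l}" for X Y
  proof -
    have 1: "card {l \<in> g ` Y. incident P (f p) l} = card {l \<in> Y. incident P' p l}" if "p \<in> X" for p
      by (rule card_image_Collect[OF inj_on_subset[OF g(1) Y(1)]]) (use i that X(1) Y(1) in blast)
    have 2: "card {p \<in> f ` X. incident P p (g l)} = card {p \<in> X. incident P' p l}" if "l \<in> Y" for l
      by (rule card_image_Collect[OF inj_on_subset[OF f(1) X(1)]]) (use i that X(1) Y(1) in blast)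
    have "f ` X \<subseteq> points P" "g ` Y \<subseteq> lines P" "finite (f ` X)" "finite (g ` Y)"
      "f ` X \<noteq> {} \<or> g ` Y \<noteq> {}"
      using f(2) g(2) X Y ne by auto
    moreover have "\<forall>p\<in>f ` X. 3 \<le> card {l \<in> g ` Y. incident P p l}"
      "\<forall>l\<in>g ` Y. 3 \<le> card {p \<in> f ` X. incident P p l}"
      using 1 2 dX dY by simp_all
    ultimately have "\<not> open_structure P"
      unfolding open_structure_def not_not
      by (intro exI[of _ "f ` X"] exI[of _ "g ` Y"] conjI)
    then show False using assms(2) by contradiction
  qed
  then show ?thesis unfolding open_structure_def by (intro notI) (elim exE conjE)
qed

section \<open>An isomorphism invariant\<close>

text \<open>
  In a free completion all but finitely many elements of the sets \<open>X\<close> and \<open>Y\<close> belong to the partial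
  plane, with exceptions depending only on \<open>A\<close> and \<open>B\<close>; choosing \<open>F\<close> and \<open>G\<close> removes the exceptions.
\<close>

definition linked :: "('p, 'l) incidence_structure \<Rightarrow> 'p \<Rightarrow> 'l \<Rightarrow> bool" where
  "linked P x y \<longleftrightarrow> (\<exists>A B. A \<subseteq> points P \<and> B \<subseteq> lines P \<and> finite A \<and> finite B \<and>
     (\<forall>F G. finite F \<longrightarrow> finite G \<longrightarrow>
        (\<exists>X Y. X \<subseteq> points P \<and> Y \<subseteq> lines P \<and> finite X \<and> finite Y \<and>
           (\<forall>p\<in>X - A. 3 \<le> card {l \<in> Y. incident P p l}) \<and>
           (\<forall>l\<in>Y - B. 3 \<le> card {p \<in> X. incident P p l}) \<and>
           (\<exists>p\<in>X - F. \<exists>l\<in>Y - G. incident P x l \<and> incident P p l \<and> incident P p y))))"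

definition linked_points :: "('p, 'l) incidence_structure \<Rightarrow> 'l \<Rightarrow> 'p set" where
  "linked_points P y = {x \<in> points P. linked P x y}"

lemma linked_image:
  assumes f: "bij_betw f (points P) (points P')" and g: "bij_betw g (lines P) (lines P')"
    and i: "\<And>p l. p \<in> points P \<Longrightarrow> l \<in> lines P \<Longrightarrow> incident P' (f p) (g l) \<longleftrightarrow> incident P p l"
    and x: "x \<in> points P" and y: "y \<in> lines P" and l: "linked P x y"
  shows "linked P' (f x) (g y)"
proof -
  have f': "inj_on f (points P)" "points P' = f ` points P"
    and g': "inj_on g (lines P)" "lines P' = g ` lines P"
    using f g by (simp_all add: bij_betw_def)
  obtain A B where A: "A \<subseteq> points P" "finite A" and B: "B \<subseteq> lines P" "finite B"
    and E: "\<forall>F G. finite F \<longrightarrow> finite G \<longrightarrow>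
        (\<exists>X Y. X \<subseteq> points P \<and> Y \<subseteq> lines P \<and> finite X \<and> finite Y \<and>
           (\<forall>p\<in>X - A. 3 \<le> card {l \<in> Y. incident P p l}) \<and>
           (\<forall>l\<in>Y - B. 3 \<le> card {p \<in> X. incident P p l}) \<and>
           (\<exists>p\<in>X - F. \<exists>l\<in>Y - G. incident P x l \<and> incident P p l \<and> incident P p y))"
    using l unfolding linked_def by (elim exE conjE) (rule that)
  have "\<exists>X Y. X \<subseteq> points P' \<and> Y \<subseteq> lines P' \<and> finite X \<and> finite Y \<and>
           (\<forall>p\<in>X - f ` A. 3 \<le> card {l \<in> Y. incident P' p l}) \<and>
           (\<forall>l\<in>Y - g ` B. 3 \<le> card {p \<in> X. incident P' p l}) \<and>
           (\<exists>p\<in>X - F. \<exists>l\<in>Y - G. incident P' (f x) l \<and> incident P' p l \<and> incident P' p (g y))"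
    if "finite F" "finite G" for F G
  proof -
    \<comment> \<open>The exceptional sets are given in \<open>P'\<close>. Injectivity keeps their
      preimages finite, and avoiding these makes the images avoid \<open>F\<close> and
      \<open>G\<close>.\<close>
    let ?F = "f -` F \<inter> points P" and ?G = "g -` G \<inter> lines P"
    have fin: "finite ?F" "finite ?G"
      using that f'(1) g'(1) by (simp_all add: finite_vimage_IntI)
    from E[THEN spec, THEN spec, THEN mp, OF fin(1), THEN mp, OF fin(2)]
    obtain X Y where X: "X \<subseteq> points P" "finite X" and Y: "Y \<subseteq> lines P" "finite Y"
      and dX: "\<forall>p\<in>X - A. 3 \<le> card {l \<in> Y. incident P p l}"
      and dY: "\<forall>l\<in>Y - B. 3 \<le> card {p \<in> X. incident P p l}"
      and path: "\<exists>p\<in>X - ?F. \<exists>l\<in>Y - ?G. incident P x l \<and> incident P p l \<and> incident P p y"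
      by (elim exE conjE) (rule that)
    from path obtain p l where p: "p \<in> X" "p \<notin> ?F" and l: "l \<in> Y" "l \<notin> ?G"
      and inc: "incident P x l" "incident P p l" "incident P p y" by blast
    have pl: "p \<in> points P" "l \<in> lines P" using p l X Y by blast+
    have 1: "card {l \<in> g ` Y. incident P' (f p) l} = card {l \<in> Y. incident P p l}" if "p \<in> X" for p
      by (rule card_image_Collect[OF inj_on_subset[OF g'(1) Y(1)]]) (use i that X(1) Y(1) in blast)
    have 2: "card {p \<in> f ` X. incident P' p (g l)} = card {p \<in> X. incident P p l}" if "l \<in> Y" for l
      by (rule card_image_Collect[OF inj_on_subset[OF f'(1) X(1)]]) (use i that X(1) Y(1) in blast)
    have "f ` X \<subseteq> points P'" "g ` Y \<subseteq> lines P'" "finite (f ` X)" "finite (g ` Y)"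
      using f'(2) g'(2) X Y by auto
    moreover have "\<forall>p\<in>f ` X - f ` A. 3 \<le> card {l \<in> g ` Y. incident P' p l}"
    proof
      fix p' assume "p' \<in> f ` X - f ` A"
      then obtain p where "p \<in> X - A" "p' = f p" by blast
      then show "3 \<le> card {l \<in> g ` Y. incident P' p' l}" using 1 dX by simp
    qed
    moreover have "\<forall>l\<in>g ` Y - g ` B. 3 \<le> card {p \<in> f ` X. incident P' p l}"
    proof
      fix l' assume "l' \<in> g ` Y - g ` B"
      then obtain l where "l \<in> Y - B" "l' = g l" by blast
      then show "3 \<le> card {p \<in> f ` X. incident P' p l'}" using 2 dY by simp
    qed
    moreover have "f p \<in> f ` X - F" "g l \<in> g ` Y - G" using p l pl by auto
    moreover have "incident P' (f x) (g l)" "incident P' (f p) (g l)" "incident P' (f p) (g y)"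
      using inc pl i x y by simp_all
    ultimately show ?thesis
      by (intro exI[of _ "f ` X"] exI[of _ "g ` Y"] conjI bexI[of _ "f p"] bexI[of _ "g l"])
  qed
  moreover have "f ` A \<subseteq> points P'" "g ` B \<subseteq> lines P'" "finite (f ` A)" "finite (g ` B)"
    using f'(2) g'(2) A B by auto
  ultimately show ?thesis
    unfolding linked_def
    by (intro exI[of _ "f ` A"], intro exI[of _ "g ` B"]) simp
qed

lemma linked_points_image:
  assumes f: "bij_betw f (points P) (points P')" and g: "bij_betw g (lines P) (lines P')"
    and i: "\<And>p l. p \<in> points P \<Longrightarrow> l \<in> lines P \<Longrightarrow> incident P' (f p) (g l) \<longleftrightarrow> incident P p l"
    and y: "y \<in> lines P"
  shows "linked_points P' (g y) = f ` linked_points P y"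
proof
  show "f ` linked_points P y \<subseteq> linked_points P' (g y)"
    unfolding linked_points_def using linked_image[OF f g i _ y] bij_betw_apply[OF f] by blast
  let ?f = "inv_into (points P) f" and ?g = "inv_into (lines P) g"
  have i': "incident P (?f p) (?g l) \<longleftrightarrow> incident P' p l" if "p \<in> points P'" "l \<in> lines P'" for p l
    using i[of "?f p" "?g l"] that f g
    by (simp add: bij_betw_def inv_into_into f_inv_into_f)
  have gy: "g y \<in> lines P'" using g y by (rule bij_betw_apply)
  show "linked_points P' (g y) \<subseteq> f ` linked_points P y"
  proof
    fix x assume "x \<in> linked_points P' (g y)"
    then have x: "x \<in> points P'" "linked P' x (g y)" unfolding linked_points_def by auto
    have "linked P (?f x) (?g (g y))"
      using linked_image[OF bij_betw_inv_into[OF f] bij_betw_inv_into[OF g] i' x(1) gy x(2)] .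
    moreover have "?g (g y) = y" using g y by (simp add: bij_betw_inv_into_left)
    moreover have "?f x \<in> points P" using bij_betw_inv_into[OF f] x(1) by (rule bij_betw_apply)
    moreover have "f (?f x) = x" using f x(1) by (simp add: bij_betw_inv_into_right)
    ultimately show "x \<in> f ` linked_points P y"
      unfolding linked_points_def by (intro image_eqI[of _ _ "?f x"]) simp_all
  qed
qed

section \<open>Free completion of a partial plane\<close>

text \<open>\<open>New x y\<close> names the line through two points or the meeting point of two
  lines. As a name records its generators, all stages of the completion fit into one type, with
  \<open>depth\<close> in place of the stage.\<close>

datatype 'e elem = Base 'e | New "'e elem" "'e elem"

primrec depth :: "'e elem \<Rightarrow> nat" where
  "depth (Base e) = 0"
| "depth (New x y) = Suc (max (depth x) (depth y))"

primrec parents :: "'e elem \<Rightarrow> 'e elem set" where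
  "parents (Base e) = {}"
| "parents (New x y) = {x, y}"

primrec subterms :: "'e elem \<Rightarrow> 'e elem set" where
  "subterms (Base e) = {Base e}"
| "subterms (New x y) = insert (New x y) (subterms x \<union> subterms y)"

lemma depth_parents: "x \<in> parents y \<Longrightarrow> depth x < depth y"
  by (cases y) auto

lemma depth_eq_0: "depth x = 0 \<longleftrightarrow> x \<in> range Base"
  by (cases x) auto

lemma finite_parents: "finite (parents x)"
  by (cases x) auto

lemma card_parents: "card (parents x) \<le> 2"
  by (cases x) (auto simp: card_insert_if)

lemma finite_subterms: "finite (subterms x)"
  by (induction x) auto

lemma self_in_subterms: "x \<in> subterms x"
  by (cases x) auto

lemma parents_in_subterms: "y \<in> subterms x \<Longrightarrow> z \<in> parents y \<Longrightarrow> z \<in> subterms x"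
  by (induction x) (auto simp: self_in_subterms)

text \<open>Selects one of the two terms \<open>New x y\<close> and \<open>New y x\<close> as the name of the new element
  joining \<open>x\<close> and \<open>y\<close>.\<close>

definition oriented :: "'e elem \<Rightarrow> 'e elem \<Rightarrow> bool" where
  "oriented x y \<longleftrightarrow> (SOME u. u \<in> {x, y}) = x"

lemma oriented_total: "oriented x y \<or> oriented y x"
proof -
  have "(SOME u. u \<in> {x, y}) \<in> {x, y}" by (rule someI[of _ x]) simp
  then show ?thesis unfolding oriented_def by (auto simp: insert_commute)
qed

lemma oriented_antisym: "oriented x y \<Longrightarrow> oriented y x \<Longrightarrow> x = y"
  unfolding oriented_def by (simp add: insert_commute)

text \<open>Points and lines share one carrier, so that one argument covers both dual cases.
  \<open>adj0_unique\<close> excludes four-cycles, and \<open>adj0_sparse\<close> is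
  openness.\<close>

locale partial_plane =
  fixes carrier :: "'e set" and pt :: "'e \<Rightarrow> bool" and adj0 :: "'e \<Rightarrow> 'e \<Rightarrow> bool"
  assumes adj0_sym: "adj0 a b \<Longrightarrow> adj0 b a"
    and adj0_carrier: "adj0 a b \<Longrightarrow> a \<in> carrier"
    and adj0_pt: "adj0 a b \<Longrightarrow> pt a \<noteq> pt b"
    and adj0_unique: "adj0 a c \<Longrightarrow> adj0 a d \<Longrightarrow> adj0 b c \<Longrightarrow> adj0 b d \<Longrightarrow> a \<noteq> b \<Longrightarrow> c = d"
    and adj0_sparse: "finite Z \<Longrightarrow> Z \<noteq> {} \<Longrightarrow> Z \<subseteq> carrier \<Longrightarrow> \<exists>z\<in>Z. card {w \<in> Z. adj0 z w} < 3"
begin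

primrec is_pt :: "'e elem \<Rightarrow> bool" where
  "is_pt (Base e) = pt e"
| "is_pt (New x y) = (\<not> is_pt x)"

definition adj :: "'e elem \<Rightarrow> 'e elem \<Rightarrow> bool" where
  "adj x y \<longleftrightarrow> (\<exists>a b. x = Base a \<and> y = Base b \<and> adj0 a b) \<or> x \<in> parents y \<or> y \<in> parents x"

text \<open>The common neighbour \<open>z\<close> ranges over all terms, since mentioning its
  validity would break the primitive recursion. By \<open>valid_common\<close> both readings agree.
  Two orders of the pair are exempted because \<open>oriented\<close> keeps only one name of the new
  element.\<close>

primrec valid :: "'e elem \<Rightarrow> bool" where
  "valid (Base e) \<longleftrightarrow> e \<in> carrier"
| "valid (New x y) \<longleftrightarrow> valid x \<and> valid y \<and> is_pt x = is_pt y \<and> x \<noteq> y \<and> oriented x y \<and>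
     \<not> (\<exists>z. z \<noteq> New x y \<and> z \<noteq> New y x \<and> adj x z \<and> adj y z)"

definition plane :: "('e elem, 'e elem) incidence_structure" where
  "plane = \<lparr>points = {x. valid x \<and> is_pt x}, lines = {x. valid x \<and> \<not> is_pt x}, incident = adj\<rparr>"

lemma plane_simps [simp]:
  "points plane = {x. valid x \<and> is_pt x}"
  "lines plane = {x. valid x \<and> \<not> is_pt x}"
  "incident plane = adj"
  by (simp_all add: plane_def)

lemma adj_sym: "adj x y \<Longrightarrow> adj y x"
  unfolding adj_def using adj0_sym by blast

lemma adj_Base [simp]: "adj (Base a) (Base b) \<longleftrightarrow> adj0 a b"
  by (simp add: adj_def)

lemma adj_Base_New [simp]: "adj (Base a) (New x y) \<longleftrightarrow> x = Base a \<or> y = Base a"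
  by (auto simp: adj_def)

lemma valid_parents: "valid y \<Longrightarrow> x \<in> parents y \<Longrightarrow> valid x"
  by (cases y) auto

lemma is_pt_parents: "valid y \<Longrightarrow> x \<in> parents y \<Longrightarrow> is_pt x \<noteq> is_pt y"
  by (cases y) auto

lemma adj_is_pt: "valid x \<Longrightarrow> valid y \<Longrightarrow> adj x y \<Longrightarrow> is_pt x \<noteq> is_pt y"
  unfolding adj_def using adj0_pt is_pt_parents by auto

lemma adj_parents:
  assumes "adj x z" and "x \<notin> range Base \<or> z \<notin> range Base" and "depth x \<le> depth z"
  shows "x \<in> parents z"
  using assms depth_parents[of z x] unfolding adj_def by auto

text \<open>A parent of \<open>x\<close> or \<open>y\<close> inherits validity, and another base
  element is placed in the carrier by \<open>adj0\<close>. In the remaining case \<open>x\<close>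
  and \<open>y\<close> are the two parents of \<open>z\<close>, which is then one of the exempted
  joins.\<close>

lemma valid_common:
  assumes v: "valid x" "valid y" and "x \<noteq> y" and a: "adj x z" "adj y z"
    and z: "z \<noteq> New x y" "z \<noteq> New y x"
  shows "valid z"
proof (cases "z \<in> parents x \<or> z \<in> parents y")
  case True
  then show ?thesis using v valid_parents by blast
next
  case False
  show ?thesis
  proof (cases z)
    case (Base e)
    then obtain b where "x = Base b" "adj0 b e" using a(1) False unfolding adj_def by auto
    then show ?thesis using Base adj0_sym adj0_carrier by auto
  next
    case (New u w)
    then have "x \<in> {u, w}" "y \<in> {u, w}" using a False unfolding adj_def by auto
    then show ?thesis using New z \<open>x \<noteq> y\<close> by auto
  qed
qed

lemma ex_common:
  assumes v: "valid x" "valid y" and "x \<noteq> y" and s: "is_pt x = is_pt y"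
  shows "\<exists>z. valid z \<and> is_pt z \<noteq> is_pt x \<and> adj x z \<and> adj y z"
proof (cases "\<exists>z. z \<noteq> New x y \<and> z \<noteq> New y x \<and> adj x z \<and> adj y z")
  case True
  then obtain z where z: "z \<noteq> New x y" "z \<noteq> New y x" "adj x z" "adj y z" by blast
  then have "valid z" using valid_common v \<open>x \<noteq> y\<close> by blast
  then show ?thesis using z adj_is_pt[OF v(1)] by blast
next
  case False
  define z where "z = (if oriented x y then New x y else New y x)"
  have "\<not> (\<exists>z. z \<noteq> New y x \<and> z \<noteq> New x y \<and> adj y z \<and> adj x z)" using False by blast
  then have "valid z"
    using v s \<open>x \<noteq> y\<close> False oriented_total[of x y] unfolding z_def
    by (auto simp del: not_ex)
  moreover have "is_pt z \<noteq> is_pt x" "adj x z" "adj y z" using s by (auto simp: z_def adj_def)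
  ultimately show ?thesis by blast
qed

text \<open>A new element at least as deep as its two neighbours in a four-cycle has both as
  parents. Its own validity forbids a second common neighbour, except for the term with swapped
  parents, which orientation makes invalid.\<close>

lemma common_unique_deepest:
  assumes z: "valid z" "z \<notin> range Base" and "x \<noteq> y" and "w \<noteq> z" and "valid w"
    and a: "adj x z" "adj y z" "adj x w" "adj y w"
    and d: "depth x \<le> depth z" "depth y \<le> depth z"
  shows False
proof -
  obtain u v where n: "z = New u v" using z(2) by (cases z) auto
  have "x \<in> parents z" "y \<in> parents z" using adj_parents a(1,2) d z(2) by blast+
  then have xy: "x = u \<and> y = v \<or> x = v \<and> y = u" using n \<open>x \<noteq> y\<close> by auto
  have "w \<noteq> New v u"
    using z(1) \<open>valid w\<close> oriented_antisym[of u v] unfolding n by auto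
  then show False using z(1) a(3,4) xy \<open>w \<noteq> z\<close> unfolding n by auto
qed

text \<open>A four-cycle of maximal depth 0 lies in the base, against \<open>adj0_unique\<close>.
  Otherwise \<open>common_unique_deepest\<close> applies at a deepest vertex, in whichever of the
  four positions it stands.\<close>

lemma common_unique:
  assumes v: "valid x" "valid y" "valid z" "valid w" and "x \<noteq> y"
    and a: "adj x z" "adj y z" "adj x w" "adj y w"
  shows "z = w"
proof (rule ccontr)
  assume "z \<noteq> w"
  note a' = a a[THEN adj_sym]
  define M where "M = Max (depth ` {x, y, z, w})"
  have le: "depth x \<le> M" "depth y \<le> M" "depth z \<le> M" "depth w \<le> M"
    unfolding M_def by (auto intro!: Max_ge)
  have "M \<in> depth ` {x, y, z, w}" unfolding M_def by (rule Max_in) auto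
  then have eq: "M = depth x \<or> M = depth y \<or> M = depth z \<or> M = depth w" by auto
  show False
  proof (cases "M = 0")
    case True
    then have "x \<in> range Base" "y \<in> range Base" "z \<in> range Base" "w \<in> range Base"
      using le depth_eq_0 by auto
    then show False using a adj0_unique \<open>x \<noteq> y\<close> \<open>z \<noteq> w\<close> by auto
  next
    case False
    then have nb: "t \<notin> range Base" if "M = depth t" for t
      using that depth_eq_0[of t] by auto
    note cu = common_unique_deepest
    from eq show False
    proof (elim disjE)
      assume "M = depth x"
      then show False using cu[of x z w y] nb[of x] v a' le \<open>x \<noteq> y\<close> \<open>z \<noteq> w\<close> by auto
    next
      assume "M = depth y"
      then show False using cu[of y z w x] nb[of y] v a' le \<open>x \<noteq> y\<close> \<open>z \<noteq> w\<close> by auto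
    next
      assume "M = depth z"
      then show False using cu[of z x y w] nb[of z] v a' le \<open>x \<noteq> y\<close> \<open>z \<noteq> w\<close> by auto
    next
      assume "M = depth w"
      then show False using cu[of w x y z] nb[of w] v a' le \<open>x \<noteq> y\<close> \<open>z \<noteq> w\<close> by auto
    qed
  qed
qed

lemma ex1_common:
  assumes v: "valid x" "valid y" and "x \<noteq> y" and s: "is_pt x = is_pt y"
  shows "\<exists>!z. valid z \<and> is_pt z \<noteq> is_pt x \<and> adj x z \<and> adj y z"
proof -
  obtain z where z: "valid z" "is_pt z \<noteq> is_pt x" "adj x z" "adj y z"
    using ex_common[OF assms] by blast
  show ?thesis
  proof (rule ex1I[of _ z])
    show "w = z" if "valid w \<and> is_pt w \<noteq> is_pt x \<and> adj x w \<and> adj y w" for w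
      using common_unique[OF v _ z(1) \<open>x \<noteq> y\<close>, of w] that z by blast
  qed (use z in blast)
qed

lemma projective_plane_plane: "projective_plane plane"
  unfolding projective_plane_def
proof (intro conjI ballI impI)
  fix p q assume "p \<in> points plane" "q \<in> points plane" "p \<noteq> q"
  then show "\<exists>!l. l \<in> lines plane \<and> incident plane p l \<and> incident plane q l"
    using ex1_common[of p q] by simp
next
  fix l m assume "l \<in> lines plane" "m \<in> lines plane" "l \<noteq> m"
  moreover have "adj x y = adj y x" for x y using adj_sym by blast
  ultimately show "\<exists>!p. p \<in> points plane \<and> incident plane p l \<and> incident plane p m"
    using ex1_common[of l m] by simp
qed

text \<open>An element outside the base has only its two parents as neighbours of at most its own depth,
  so among the elements of \<open>Z\<close> outside the base a deepest one lies in \<open>A\<close>.\<close>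

lemma dense_subset_subterms:
  assumes fin: "finite Z" and dense: "\<And>w. w \<in> Z - A \<Longrightarrow> 3 \<le> card {v \<in> Z. adj w v}"
    and "z \<in> Z" and "z \<notin> range Base"
  shows "\<exists>a\<in>A. z \<in> subterms a"
  using assms(3,4)
proof (induction "Max (depth ` Z) - depth z" arbitrary: z rule: less_induct)
  case less
  show ?case
  proof (cases "z \<in> A")
    case True
    then show ?thesis using self_in_subterms by blast
  next
    case False
    have "\<not> {v \<in> Z. adj z v} \<subseteq> parents z"
    proof
      assume "{v \<in> Z. adj z v} \<subseteq> parents z"
      then have "card {v \<in> Z. adj z v} \<le> 2"
        using card_mono[OF finite_parents] card_parents order_trans by blast
      then show False using dense[of z] False less.prems by auto
    qed
    then obtain w where w: "w \<in> Z" "adj z w" "w \<notin> parents z" by blast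
    then have zw: "z \<in> parents w" using less.prems(2) unfolding adj_def by auto
    then have "depth z < depth w" by (rule depth_parents)
    moreover have "depth w \<le> Max (depth ` Z)" using w(1) fin by auto
    ultimately have "Max (depth ` Z) - depth w < Max (depth ` Z) - depth z" by linarith
    moreover have "w \<notin> range Base" using zw by auto
    ultimately have "\<exists>a\<in>A. w \<in> subterms a" using less.hyps w(1) by blast
    then show ?thesis using parents_in_subterms zw by blast
  qed
qed

text \<open>Merges the points and lines in the definitions of \<open>open_structure\<close> and
  \<open>linked\<close> into one set of elements. Neighbours have opposite sorts, so no degree
  changes.\<close>

lemma card_adj_bipartite:
  assumes X: "X \<subseteq> points plane" and Y: "Y \<subseteq> lines plane"
    and dX: "\<forall>p\<in>X - A. 3 \<le> card {l \<in> Y. incident plane p l}"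
    and dY: "\<forall>l\<in>Y - B. 3 \<le> card {p \<in> X. incident plane p l}"
    and w: "w \<in> (X \<union> Y) - (A \<union> B)"
  shows "3 \<le> card {v \<in> X \<union> Y. adj w v}"
proof (cases "w \<in> X")
  case True
  then have "{v \<in> X \<union> Y. adj w v} = {l \<in> Y. incident plane w l}"
    using X Y adj_is_pt by auto blast
  then show ?thesis using dX True w by auto
next
  case False
  then have "w \<in> Y" using w by blast
  then have "{v \<in> X \<union> Y. adj w v} = {p \<in> X. incident plane p w}"
    using X Y adj_is_pt adj_sym by auto blast+
  then show ?thesis using dY \<open>w \<in> Y\<close> w by auto
qed

text \<open>Without exceptional elements \<open>dense_subset_subterms\<close> leaves nothing outside
  the base, and a finite dense set of base elements contradicts \<open>adj0_sparse\<close>.\<close>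

lemma open_structure_plane: "open_structure plane"
  unfolding open_structure_def
proof (intro notI, elim exE conjE)
  fix X Y assume X: "X \<subseteq> points plane" "finite X" and Y: "Y \<subseteq> lines plane" "finite Y"
    and ne: "X \<noteq> {} \<or> Y \<noteq> {}"
    and d: "\<forall>p\<in>X. 3 \<le> card {l \<in> Y. incident plane p l}"
    "\<forall>l\<in>Y. 3 \<le> card {p \<in> X. incident plane p l}"
  define Z where "Z = X \<union> Y"
  define Z0 where "Z0 = {e. Base e \<in> Z}"
  have dense: "3 \<le> card {v \<in> Z. adj w v}" if "w \<in> Z" for w
    unfolding Z_def
    by (rule card_adj_bipartite[where A = "{}" and B = "{}"])
      (use X Y d that in \<open>simp_all add: Z_def\<close>)
  have fin: "finite Z" unfolding Z_def using X Y by simp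
  have "z \<in> range Base" if "z \<in> Z" for z
    using dense_subset_subterms[OF fin, of "{}" z] dense that by blast
  then have Z: "Z = Base ` Z0" unfolding Z0_def by blast
  have inj: "inj_on Base S" for S :: "'e set" by (simp add: inj_on_def)
  have "finite Z0" using fin Z finite_imageD inj by metis
  moreover have "Z0 \<noteq> {}" using ne Z unfolding Z_def by blast
  moreover have "Z0 \<subseteq> carrier" using X Y unfolding Z0_def Z_def by auto
  ultimately obtain z where z: "z \<in> Z0" "card {w \<in> Z0. adj0 z w} < 3"
    using adj0_sparse by blast
  have "{v \<in> Z. adj (Base z) v} = Base ` {w \<in> Z0. adj0 z w}"
    using Z by auto
  then have "card {v \<in> Z. adj (Base z) v} < 3"
    using z(2) card_image[OF inj] by metis
  then show False using dense[of "Base z"] z(1) unfolding Z0_def by auto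
qed

section \<open>Linked pairs in the free completion\<close>

text \<open>Dense sets lie in the base up to finitely many exceptions, so a link forces a path
  inside the partial plane. The choice of \<open>H\<close> lets its two inner elements be steered
  away from any finite set.\<close>

lemma linked_plane_base:
  assumes "linked plane x y" and "finite (H :: 'e set)"
  obtains a l p b where "x = Base a" "y = Base b" "l \<notin> H" "p \<notin> H" "adj0 a l" "adj0 p l" "adj0 p b"
proof -
  from assms(1) obtain A B where A: "A \<subseteq> points plane" "finite A" and B: "B \<subseteq> lines plane" "finite B"
    and E: "\<forall>F G. finite F \<longrightarrow> finite G \<longrightarrow>
        (\<exists>X Y. X \<subseteq> points plane \<and> Y \<subseteq> lines plane \<and> finite X \<and> finite Y \<and>
           (\<forall>p\<in>X - A. 3 \<le> card {l \<in> Y. incident plane p l}) \<and>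
           (\<forall>l\<in>Y - B. 3 \<le> card {p \<in> X. incident plane p l}) \<and>
           (\<exists>p\<in>X - F. \<exists>l\<in>Y - G. incident plane x l \<and> incident plane p l \<and> incident plane p y))"
    unfolding linked_def by (elim exE conjE) (rule that)
  \<comment> \<open>Avoiding the subterms of \<open>A\<close> and \<open>B\<close> puts
    \<open>p\<close> and \<open>l\<close> in the base. Avoiding the parents of \<open>x\<close> and
    \<open>y\<close> then puts these in the base too, since a base neighbour of a new element is one
    of its parents.\<close>
  define F where "F = \<Union> (subterms ` (A \<union> B)) \<union> parents x \<union> parents y \<union> Base ` H"
  have fin: "finite F" unfolding F_def using A B finite_subterms finite_parents assms(2) by blast
  from E[THEN spec, THEN spec, THEN mp, OF fin, THEN mp, OF fin]
  obtain X Y where X: "X \<subseteq> points plane" "finite X" and Y: "Y \<subseteq> lines plane" "finite Y"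
    and dX: "\<forall>p\<in>X - A. 3 \<le> card {l \<in> Y. incident plane p l}"
    and dY: "\<forall>l\<in>Y - B. 3 \<le> card {p \<in> X. incident plane p l}"
    and path: "\<exists>p\<in>X - F. \<exists>l\<in>Y - F. incident plane x l \<and> incident plane p l \<and> incident plane p y"
    by (elim exE conjE) (rule that)
  from path obtain p l where p: "p \<in> X" "p \<notin> F" and l: "l \<in> Y" "l \<notin> F"
    and a: "adj x l" "adj p l" "adj p y" by auto
  have base: "z \<in> range Base" if "z \<in> X \<union> Y" "z \<notin> F" for z
  proof (rule ccontr)
    assume nb: "z \<notin> range Base"
    have "\<exists>a\<in>A \<union> B. z \<in> subterms a"
      by (rule dense_subset_subterms[of "X \<union> Y", OF _ _ that(1) nb])
        (use X Y card_adj_bipartite[OF X(1) Y(1) dX dY] in simp_all)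
    then show False using that(2) unfolding F_def by blast
  qed
  obtain p0 where p0: "p = Base p0" using base[of p] p by blast
  obtain l0 where l0: "l = Base l0" using base[of l] l by blast
  have "l \<notin> parents x" "p \<notin> parents y" using p(2) l(2) unfolding F_def by blast+
  then have "x \<in> range Base" "y \<in> range Base" using a(1,3) p0 l0 unfolding adj_def by auto
  then obtain a0 b0 where "x = Base a0" "y = Base b0" by blast
  moreover have "l0 \<notin> H" "p0 \<notin> H" using p(2) l(2) p0 l0 unfolding F_def by auto
  moreover have "adj0 p0 l0" using a(2) p0 l0 by simp
  ultimately show thesis using a(1,3) p0 l0 that[of a0 b0 l0 p0] by simp
qed

text \<open>The completion does not change adjacency between base elements, so degrees inside a
  finite set of them survive. It remains to split the set into points and lines.\<close>

lemma linked_planeI: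
  assumes A: "A \<subseteq> carrier" "finite A" and "pt a"
    and E: "\<And>F. finite F \<Longrightarrow> \<exists>Z. Z \<subseteq> carrier \<and> finite Z \<and> (\<forall>z\<in>Z - A. 3 \<le> card {w \<in> Z. adj0 z w}) \<and>
      (\<exists>p\<in>Z - F. \<exists>l\<in>Z - F. adj0 a l \<and> adj0 p l \<and> adj0 p b)"
  shows "linked plane (Base a) (Base b)"
proof -
  define pts where "pts Z = Base ` {z \<in> Z. pt z}" for Z
  define lns where "lns Z = Base ` {z \<in> Z. \<not> pt z}" for Z
  have sub: "pts Z \<subseteq> points plane" "lns Z \<subseteq> lines plane" if "Z \<subseteq> carrier" for Z
    using that unfolding pts_def lns_def by auto
  have fin: "finite (pts Z)" "finite (lns Z)" if "finite Z" for Z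
    using that unfolding pts_def lns_def by auto
  have inj: "inj_on Base S" for S :: "'e set" by (simp add: inj_on_def)
  have 1: "card {l \<in> lns Z. incident plane (Base z) l} = card {w \<in> Z. adj0 z w}" if "pt z" for z Z
  proof -
    have "{l \<in> lns Z. incident plane (Base z) l} = Base ` {w \<in> Z. adj0 z w}"
      using adj0_pt that unfolding lns_def by auto
    then show ?thesis by (simp add: card_image inj)
  qed
  have 2: "card {p \<in> pts Z. incident plane p (Base z)} = card {w \<in> Z. adj0 z w}" if "\<not> pt z" for z Z
  proof -
    have "{p \<in> pts Z. incident plane p (Base z)} = Base ` {w \<in> Z. adj0 z w}"
      using adj0_pt adj0_sym that unfolding pts_def by auto
    then show ?thesis by (simp add: card_image inj)
  qed
  have "\<exists>X Y. X \<subseteq> points plane \<and> Y \<subseteq> lines plane \<and> finite X \<and> finite Y \<and>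
           (\<forall>p\<in>X - pts A. 3 \<le> card {l \<in> Y. incident plane p l}) \<and>
           (\<forall>l\<in>Y - lns A. 3 \<le> card {p \<in> X. incident plane p l}) \<and>
           (\<exists>p\<in>X - F. \<exists>l\<in>Y - G. incident plane (Base a) l \<and> incident plane p l \<and>
              incident plane p (Base b))"
    if "finite F" "finite G" for F G
  proof -
    have "finite (Base -` F \<union> Base -` G)"
      using that inj by (simp add: finite_vimageI)
    from E[OF this] obtain Z where Z: "Z \<subseteq> carrier" "finite Z"
      and d: "\<forall>z\<in>Z - A. 3 \<le> card {w \<in> Z. adj0 z w}"
      and path: "\<exists>p\<in>Z - (Base -` F \<union> Base -` G). \<exists>l\<in>Z - (Base -` F \<union> Base -` G).
         adj0 a l \<and> adj0 p l \<and> adj0 p b"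
      by (elim exE conjE) (rule that)
    from path obtain p l where p: "p \<in> Z" "Base p \<notin> F" and l: "l \<in> Z" "Base l \<notin> G"
      and inc: "adj0 a l" "adj0 p l" "adj0 p b" by blast
    have "\<not> pt l" using inc(1) adj0_pt \<open>pt a\<close> by blast
    then have "pt p" using inc(2) adj0_pt by blast
    have "\<forall>p\<in>pts Z - pts A. 3 \<le> card {l \<in> lns Z. incident plane p l}"
    proof
      fix q assume "q \<in> pts Z - pts A"
      then obtain z where "q = Base z" "z \<in> Z - A" "pt z" unfolding pts_def by blast
      then show "3 \<le> card {l \<in> lns Z. incident plane q l}" using 1 d by simp
    qed
    moreover have "\<forall>l\<in>lns Z - lns A. 3 \<le> card {p \<in> pts Z. incident plane p l}"
    proof
      fix q assume "q \<in> lns Z - lns A"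
      then obtain z where "q = Base z" "z \<in> Z - A" "\<not> pt z" unfolding lns_def by blast
      then show "3 \<le> card {p \<in> pts Z. incident plane p q}" using 2 d by simp
    qed
    moreover have "Base p \<in> pts Z - F" "Base l \<in> lns Z - G"
      using p l \<open>pt p\<close> \<open>\<not> pt l\<close> unfolding pts_def lns_def by auto
    moreover have "incident plane (Base a) (Base l)" "incident plane (Base p) (Base l)"
      "incident plane (Base p) (Base b)"
      using inc by simp_all
    ultimately show ?thesis
      using sub[OF Z(1)] fin[OF Z(2)]
      by - (rule exI[of _ "pts Z"], rule exI[of _ "lns Z"],
          intro conjI bexI[of _ "Base p"] bexI[of _ "Base l"])
  qed
  then show ?thesis
    unfolding linked_def using sub[OF A(1)] fin[OF A(2)]
    by - (rule exI[of _ "pts A"], rule exI[of _ "lns A"], simp)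
qed

section \<open>Cardinality of the free completion\<close>

text \<open>Every valid term appears in one of countably many levels, each obtained from the
  previous one by adjoining all pairs. Squares and countable unions stay below an infinite
  cardinal.\<close>

lemma card_of_valid:
  assumes "Cinfinite r" and C: "|carrier| \<le>o r"
  shows "|{x. valid x}| \<le>o r"
proof -
  have inf: "\<not> finite (Field r)" and cr: "Card_order r"
    using assms(1) by (auto simp: cinfinite_def)
  define level where "level = rec_nat (Base ` carrier) (\<lambda>_ L. L \<union> case_prod New ` (L \<times> L))"
  have level: "level 0 = Base ` carrier"
    "\<And>n. level (Suc n) = level n \<union> case_prod New ` (level n \<times> level n)"
    by (simp_all add: level_def)
  have card_level: "|level n| \<le>o r" for n
  proof (induction n)
    case 0
    then show ?case unfolding level using card_of_image C ordLeq_transitive by blast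
  next
    case (Suc n)
    have "|level n \<times> level n| \<le>o r"
      by (rule card_of_Times_ordLeq_infinite_Field[OF inf Suc Suc cr])
    then have "|case_prod New ` (level n \<times> level n)| \<le>o r"
      using card_of_image ordLeq_transitive by blast
    then show ?case unfolding level by (rule card_of_Un_ordLeq_infinite_Field[OF inf Suc _ cr])
  qed
  have nat: "|UNIV :: nat set| \<le>o r"
    using inf infinite_iff_card_of_nat cr by (metis card_of_Field_ordIso ordLeq_ordIso_trans)
  have union: "|\<Union>n. level n| \<le>o r"
    by (rule card_of_UNION_ordLeq_infinite_Field[OF inf cr nat]) (use card_level in blast)
  have mono: "level m \<subseteq> level n" if "m \<le> n" for m n
    using that by (induction rule: dec_induct) (auto simp: level)
  have "x \<in> (\<Union>n. level n)" if "valid x" for x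
    using that
  proof (induction x)
    case (Base e)
    then have "Base e \<in> level 0" by (simp add: level)
    then show ?case by blast
  next
    case (New x y)
    then obtain m n where "x \<in> level m" "y \<in> level n" by auto
    then have "x \<in> level (max m n)" "y \<in> level (max m n)"
      using mono[of m "max m n"] mono[of n "max m n"] by auto
    then have "New x y \<in> level (Suc (max m n))" by (auto simp: level)
    then show ?case by blast
  qed
  then have "{x. valid x} \<subseteq> (\<Union>n. level n)" by blast
  then show ?thesis using card_of_mono1 union ordLeq_transitive by blast
qed

end

section \<open>Coding a subset of a well-order\<close>

text \<open>The arc \<open>(a, b, i)\<close> runs from \<open>Vertex a\<close> to \<open>Marker (b, i)\<close>.\<close>

type_synonym 'a arc = "'a \<times> 'a \<times> bool"

text \<open>The markers \<open>(b, False)\<close> and \<open>(b, True)\<close> are the two copies of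
  the line for \<open>b\<close>. \<open>Centre\<close> and \<open>Axis\<close> are shared by all
  chains, whereas \<open>Track e\<close> carries the nodes of the chain of \<open>e\<close>
  alone.\<close>

datatype 'a config =
    Vertex 'a
  | Marker "'a \<times> bool"
  | Centre
  | Axis
  | Track "'a arc"
  | Node "'a arc" nat
  | Line1 "'a arc" nat
  | Line2 "'a arc" nat
  | Point1 "'a arc" nat
  | Point2 "'a arc" nat
  | Diagonal "'a arc" nat

primrec config_pt :: "'a config \<Rightarrow> bool" where
  "config_pt (Vertex a) \<longleftrightarrow> True"
| "config_pt (Marker b) \<longleftrightarrow> False"
| "config_pt Centre \<longleftrightarrow> True"
| "config_pt Axis \<longleftrightarrow> False"
| "config_pt (Track e) \<longleftrightarrow> False"
| "config_pt (Node e n) \<longleftrightarrow> True"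
| "config_pt (Line1 e n) \<longleftrightarrow> False"
| "config_pt (Line2 e n) \<longleftrightarrow> False"
| "config_pt (Point1 e n) \<longleftrightarrow> True"
| "config_pt (Point2 e n) \<longleftrightarrow> True"
| "config_pt (Diagonal e n) \<longleftrightarrow> False"

text \<open>
  From \<open>Node e (n + 1)\<close>, the lines joining it to two fixed points are intersected with two fixed lines; the
  line through the two intersection points meets the track in \<open>Node e n\<close>. The index thus decreases
  along the construction, which has no first step. This is what gives every element of the chain
  except \<open>Node e 0\<close> degree at least three.
\<close>

primrec config_parents :: "'a config \<Rightarrow> 'a config set" where
  "config_parents (Vertex a) = {}"
| "config_parents (Marker b) = {}"
| "config_parents Centre = {}"
| "config_parents Axis = {}"
| "config_parents (Track e) = {}"
| "config_parents (Node e n) = {Diagonal e n, Track e}"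
| "config_parents (Line1 e n) = {Node e (Suc n), Vertex (fst e)}"
| "config_parents (Line2 e n) = {Node e (Suc n), Centre}"
| "config_parents (Point1 e n) = {Line1 e n, Marker (snd e)}"
| "config_parents (Point2 e n) = {Line2 e n, Axis}"
| "config_parents (Diagonal e n) = {Point1 e n, Point2 e n}"

text \<open>Inside a chain children lie lower than their parents. Hence a lowest element of a finite
  set, among those having parents, is adjacent there only to its parents. Minimal height does for
  chains what maximal depth does for the completion.\<close>

primrec height :: "'a config \<Rightarrow> nat" where
  "height (Vertex a) = 0"
| "height (Marker b) = 0"
| "height Centre = 0"
| "height Axis = 0"
| "height (Track e) = 0"
| "height (Node e n) = 4 * n"
| "height (Diagonal e n) = 4 * n + 1"
| "height (Point1 e n) = 4 * n + 2"
| "height (Point2 e n) = 4 * n + 2"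
| "height (Line1 e n) = 4 * n + 3"
| "height (Line2 e n) = 4 * n + 3"

lemma height_parents:
  "x \<in> config_parents y \<Longrightarrow> config_parents x \<noteq> {} \<Longrightarrow> height y < height x"
  by (cases y) auto

lemma finite_config_parents: "finite (config_parents x)"
  by (cases x) auto

lemma card_config_parents: "card (config_parents x) \<le> 2"
  by (cases x) (auto simp: card_insert_if)

definition touches :: "'a config \<Rightarrow> 'a config \<Rightarrow> bool" where
  "touches x y \<longleftrightarrow> x \<in> config_parents y \<or> y \<in> config_parents x"

lemma touches_pt: "touches x y \<Longrightarrow> config_pt x \<noteq> config_pt y"
  unfolding touches_def by (cases x; cases y) auto

lemma touches_parents_unique:
  assumes "x \<in> config_parents z" "y \<in> config_parents z" "x \<noteq> y" "touches x w" "touches y w"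
  shows "w = z"
  using assms unfolding touches_def by (cases z; cases w) auto

text \<open>Among the vertices of a four-cycle that have parents, a lowest one has both its cycle
  neighbours as parents. By \<open>touches_parents_unique\<close> the opposite vertex coincides with
  it.\<close>

lemma touches_unique:
  assumes t: "touches a c" "touches a d" "touches b c" "touches b d" and "a \<noteq> b"
  shows "c = d"
proof (rule ccontr)
  assume "c \<noteq> d"
  define M where "M = {x \<in> {a, b, c, d}. config_parents x \<noteq> {}}"
  have "M \<noteq> {}" "finite M" using t(1) unfolding M_def touches_def by auto
  then obtain z where z: "z \<in> M" and low: "\<And>x. x \<in> M \<Longrightarrow> height z \<le> height x"
    using arg_min_if_finite[of M height] by (metis not_less)
  have up: "x \<in> config_parents z" if "touches x z" "x \<in> {a, b, c, d}" for x
  proof (rule ccontr)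
    assume "x \<notin> config_parents z"
    then have "z \<in> config_parents x" using that(1) unfolding touches_def by blast
    then have "height x < height z" "x \<in> M"
      using height_parents z that(2) unfolding M_def by auto
    then show False using low by (simp add: leD)
  qed
  have sym: "touches y x" if "touches x y" for x y :: "'a config"
    using that unfolding touches_def by blast
  have u: False if "touches x z" "touches y z" "touches x w" "touches y w" "x \<noteq> y" "w \<noteq> z"
    "x \<in> {a, b, c, d}" "y \<in> {a, b, c, d}" for x y w
    using touches_parents_unique up that by blast
  from z consider "z = a" | "z = b" | "z = c" | "z = d" unfolding M_def by blast
  then show False
  proof cases
    case 1
    then show False using u[of c d b] t t[THEN sym] \<open>a \<noteq> b\<close> \<open>c \<noteq> d\<close> by simp
  next
    case 2
    then show False using u[of c d a] t t[THEN sym] \<open>a \<noteq> b\<close> \<open>c \<noteq> d\<close> by simp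
  next
    case 3
    then show False using u[of a b d] t \<open>a \<noteq> b\<close> \<open>c \<noteq> d\<close> by simp
  next
    case 4
    then show False using u[of a b c] t \<open>a \<noteq> b\<close> \<open>c \<noteq> d\<close> by simp
  qed
qed

text \<open>Each kind of chain element occurs as a parent at most twice. This serves to recognise
  the ends of chains: a path whose inner elements avoid all finite neighbourhoods of its two ends
  must start and finish at elements without parents.\<close>

lemma finite_touches:
  assumes "config_parents x \<noteq> {}"
  shows "finite {y. touches x y}"
proof -
  have "finite {y. x \<in> config_parents y}"
  proof (cases x)
    case (Node e n)
    \<comment> \<open>\<open>Node e 0\<close> is nobody's parent, so truncated subtraction merely
      enlarges the bound there.\<close>
    have "{y. x \<in> config_parents y} \<subseteq> {Line1 e (n - 1), Line2 e (n - 1)}"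
    proof
      show "y \<in> {Line1 e (n - 1), Line2 e (n - 1)}" if "y \<in> {y. x \<in> config_parents y}" for y
        using that Node by (cases y) auto
    qed
    then show ?thesis using finite_subset by blast
  next
    case (Line1 e n)
    have "y = Point1 e n" if "x \<in> config_parents y" for y
      using that Line1 by (cases y) auto
    then have "{y. x \<in> config_parents y} \<subseteq> {Point1 e n}" by blast
    then show ?thesis using finite_subset by blast
  next
    case (Line2 e n)
    have "y = Point2 e n" if "x \<in> config_parents y" for y
      using that Line2 by (cases y) auto
    then have "{y. x \<in> config_parents y} \<subseteq> {Point2 e n}" by blast
    then show ?thesis using finite_subset by blast
  next
    case (Point1 e n)
    have "y = Diagonal e n" if "x \<in> config_parents y" for y
      using that Point1 by (cases y) auto
    then have "{y. x \<in> config_parents y} \<subseteq> {Diagonal e n}" by blast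
    then show ?thesis using finite_subset by blast
  next
    case (Point2 e n)
    have "y = Diagonal e n" if "x \<in> config_parents y" for y
      using that Point2 by (cases y) auto
    then have "{y. x \<in> config_parents y} \<subseteq> {Diagonal e n}" by blast
    then show ?thesis using finite_subset by blast
  next
    case (Diagonal e n)
    have "y = Node e n" if "x \<in> config_parents y" for y
      using that Diagonal by (cases y) auto
    then have "{y. x \<in> config_parents y} \<subseteq> {Node e n}" by blast
    then show ?thesis using finite_subset by blast
  qed (use assms in auto)
  moreover have "{y. touches x y} = {y. x \<in> config_parents y} \<union> config_parents x"
    unfolding touches_def by blast
  ultimately show ?thesis using finite_config_parents by simp
qed

definition arc :: "'a rel \<Rightarrow> 'a set \<Rightarrow> 'a arc \<Rightarrow> bool" where
  "arc r S e \<longleftrightarrow> (fst (snd e), fst e) \<in> r \<and> (snd (snd e) \<longrightarrow> fst (snd e) \<in> S)"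

primrec in_config :: "'a rel \<Rightarrow> 'a set \<Rightarrow> 'a config \<Rightarrow> bool" where
  "in_config r S (Vertex a) \<longleftrightarrow> a \<in> Field r"
| "in_config r S (Marker b) \<longleftrightarrow> fst b \<in> Field r \<and> (snd b \<longrightarrow> fst b \<in> S)"
| "in_config r S Centre \<longleftrightarrow> True"
| "in_config r S Axis \<longleftrightarrow> True"
| "in_config r S (Track e) \<longleftrightarrow> arc r S e"
| "in_config r S (Node e n) \<longleftrightarrow> arc r S e"
| "in_config r S (Line1 e n) \<longleftrightarrow> arc r S e"
| "in_config r S (Line2 e n) \<longleftrightarrow> arc r S e"
| "in_config r S (Point1 e n) \<longleftrightarrow> arc r S e"
| "in_config r S (Point2 e n) \<longleftrightarrow> arc r S e"
| "in_config r S (Diagonal e n) \<longleftrightarrow> arc r S e"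

definition config :: "'a rel \<Rightarrow> 'a set \<Rightarrow> 'a config set" where
  "config r S = {x. in_config r S x}"

lemma mem_config [simp]: "x \<in> config r S \<longleftrightarrow> in_config r S x"
  by (simp add: config_def)

definition config_adj :: "'a rel \<Rightarrow> 'a set \<Rightarrow> 'a config \<Rightarrow> 'a config \<Rightarrow> bool" where
  "config_adj r S x y \<longleftrightarrow> in_config r S x \<and> in_config r S y \<and> touches x y"

text \<open>A lowest element with parents sees only those parents in \<open>Z\<close>, at most two.
  If no element of \<open>Z\<close> has parents, no two of them touch.\<close>

lemma config_sparse:
  assumes "finite Z" and "Z \<noteq> {}"
  shows "\<exists>z\<in>Z. card {w \<in> Z. config_adj r S z w} < 3"
proof (cases "\<exists>z\<in>Z. config_parents z \<noteq> {}")
  case True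
  let ?M = "{z \<in> Z. config_parents z \<noteq> {}}"
  have "?M \<noteq> {}" "finite ?M" using True assms(1) by auto
  then obtain z where z: "z \<in> ?M" and low: "\<And>x. x \<in> ?M \<Longrightarrow> height z \<le> height x"
    using arg_min_if_finite[of ?M height] by (metis (no_types, lifting) not_less)
  have "{w \<in> Z. config_adj r S z w} \<subseteq> config_parents z"
  proof
    fix w assume w: "w \<in> {w \<in> Z. config_adj r S z w}"
    show "w \<in> config_parents z"
    proof (rule ccontr)
      assume "w \<notin> config_parents z"
      then have "z \<in> config_parents w" using w unfolding config_adj_def touches_def by auto
      then have "height w < height z" "w \<in> ?M" using height_parents z w by auto
      then show False using low by (simp add: leD)
    qed
  qed
  then have "card {w \<in> Z. config_adj r S z w} \<le> 2"
    using card_mono[OF finite_config_parents] card_config_parents order_trans by blast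
  then show ?thesis using z by (intro bexI[of _ z]) auto
next
  case False
  obtain z where "z \<in> Z" using assms(2) by blast
  have none: "{w \<in> Z. config_adj r S z w} = {}"
    using False \<open>z \<in> Z\<close> unfolding config_adj_def touches_def by blast
  show ?thesis by (rule bexI[OF _ \<open>z \<in> Z\<close>]) (simp add: none)
qed

interpretation config: partial_plane "config r S" config_pt "config_adj r S" for r :: "'a rel" and S
proof
  show "config_adj r S b a" if "config_adj r S a b" for a b
    using that unfolding config_adj_def touches_def by blast
  show "a \<in> config r S" if "config_adj r S a b" for a b
    using that unfolding config_adj_def by auto
  show "config_pt a \<noteq> config_pt b" if "config_adj r S a b" for a b
    using that touches_pt unfolding config_adj_def by blast
  show "c = d" if "config_adj r S a c" "config_adj r S a d" "config_adj r S b c"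
    "config_adj r S b d" "a \<noteq> b" for a b c d
    using that touches_unique unfolding config_adj_def by blast
qed (rule config_sparse)

abbreviation config_plane ::
  "'a rel \<Rightarrow> 'a set \<Rightarrow> ('a config elem, 'a config elem) incidence_structure" where
  "config_plane r S \<equiv> config.plane r S"

section \<open>Linked pairs in the coding plane\<close>

text \<open>Only \<open>Line1\<close> and \<open>Line2\<close> have a parentless point as parent,
  and only \<open>Point1\<close>, \<open>Point2\<close> and \<open>Node\<close> a parentless line.
  The four ways in which such elements can be adjacent give the listed pairs. An upper bound
  suffices, as the pairs without a marker add at most two points to each line.\<close>

lemma linked_config_plane:
  assumes l: "linked (config_plane r S) x y"
    and x: "x \<in> points (config_plane r S)" and y: "y \<in> lines (config_plane r S)"
  shows "(\<exists>e. arc r S e \<and> x = Base (Vertex (fst e)) \<and> y = Base (Marker (snd e))) \<or>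
    (\<exists>e. x \<in> {Base (Vertex (fst e)), Base Centre} \<and> y = Base (Track e)) \<or>
    (x = Base Centre \<and> y = Base Axis)"
proof -
  obtain a b where ab: "x = Base a" "y = Base b"
    using config.linked_plane_base[OF l finite.emptyI] by metis
  \<comment> \<open>The set of neighbours where it is known to be finite, and empty at parentless
    elements, so that it can always be avoided.\<close>
  define N where "N z = (if config_parents z = {} then {} else {w. touches z w})" for z :: "'a config"
  have "finite (N a \<union> N b)" unfolding N_def using finite_touches by auto
  from config.linked_plane_base[OF l this] obtain l p where lp: "l \<notin> N a" "p \<notin> N b"
    and t: "touches a l" "touches p l" "touches p b" and e: "in_config r S p"
    unfolding ab elem.inject config_adj_def by (metis UnCI)
  have a: "config_parents a = {}" using lp(1) t(1) unfolding N_def by (metis mem_Collect_eq)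
  have b: "config_parents b = {}"
    using lp(2) t(3) unfolding N_def touches_def by (auto split: if_splits)
  have pt: "config_pt a" "\<not> config_pt b" using x y ab by auto
  have l: "a \<in> config_parents l" and p: "b \<in> config_parents p"
    using t(1,3) a b unfolding touches_def by auto
  have "(\<exists>f n. l = Line1 f n \<and> a = Vertex (fst f)) \<or> (\<exists>f n. l = Line2 f n \<and> a = Centre)"
    using l a pt(1) by (cases l) auto
  moreover have "(\<exists>f n. p = Point1 f n \<and> b = Marker (snd f)) \<or> (\<exists>f n. p = Point2 f n \<and> b = Axis) \<or>
      (\<exists>f n. p = Node f n \<and> b = Track f)"
    using p b pt(2) by (cases p) auto
  ultimately show ?thesis
    using t(2) e unfolding ab touches_def by auto
qed

text \<open>In the part of the chain up to index \<open>n\<close>, taken with its ends, everything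
  outside \<open>?A\<close> has degree at least three. As \<open>?A\<close> does not depend on
  \<open>n\<close>, the path through \<open>Line1 e n\<close> and \<open>Point1 e n\<close> can be
  moved off any finite set.\<close>

lemma linked_arc:
  assumes e: "arc r S e" and F: "fst e \<in> Field r" "fst (snd e) \<in> Field r"
  shows "linked (config_plane r S) (Base (Vertex (fst e))) (Base (Marker (snd e)))"
proof (rule config.linked_planeI)
  let ?A = "{Vertex (fst e), Centre, Marker (snd e), Axis, Track e, Node e 0}"
  show "?A \<subseteq> config r S" "finite ?A" "config_pt (Vertex (fst e))"
    using e F by (auto simp: arc_def)
  fix F :: "'a config set" assume "finite F"
  have "finite {n. Line1 e n \<in> F}" "finite {n. Point1 e n \<in> F}"
    using \<open>finite F\<close> finite_vimageI[of F "Line1 e"] finite_vimageI[of F "Point1 e"]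
    by (auto simp: vimage_def inj_def)
  then obtain n where n: "n \<notin> {n. Line1 e n \<in> F} \<union> {n. Point1 e n \<in> F}"
    using ex_new_if_finite[OF infinite_UNIV_nat] by (metis finite_UnI)
  \<comment> \<open>Nodes run up to \<open>Suc n\<close> because \<open>Line1 e n\<close> and
    \<open>Line2 e n\<close> start from that node.\<close>
  define Z where "Z = ?A \<union> Node e ` {..Suc n} \<union> Line1 e ` {..n} \<union> Line2 e ` {..n} \<union>
    Point1 e ` {..n} \<union> Point2 e ` {..n} \<union> Diagonal e ` {..n}"
  have Z: "Z \<subseteq> config r S" "finite Z"
    using e F unfolding Z_def by (auto simp: arc_def)
  have three: "3 \<le> card {w \<in> Z. config_adj r S z w}"
    if "z \<in> Z" "{u, v, w} \<subseteq> Z" "touches z u" "touches z v" "touches z w" "card {u, v, w} = 3"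
    for z u v w
  proof -
    have "{u, v, w} \<subseteq> {w \<in> Z. config_adj r S z w}"
      using that Z(1) unfolding config_adj_def by auto
    then show ?thesis using card_mono[of "{w \<in> Z. config_adj r S z w}" "{u, v, w}"] Z(2) that(6)
      by simp
  qed
  have "3 \<le> card {w \<in> Z. config_adj r S z w}" if z: "z \<in> Z - ?A" for z
  proof -
    have zZ: "z \<in> Z" using z by simp
    from z consider k where "z = Node e (Suc k)" "k \<le> n"
      | k where "z = Line1 e k" "k \<le> n" | k where "z = Line2 e k" "k \<le> n"
      | k where "z = Point1 e k" "k \<le> n" | k where "z = Point2 e k" "k \<le> n"
      | k where "z = Diagonal e k" "k \<le> n"
    proof -
      have "\<exists>k\<le>n. m = Suc k" if "m \<le> Suc n" "m \<noteq> 0" for m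
        using that by (cases m) auto
      then show ?thesis using z that unfolding Z_def by (auto; blast)
    qed
    then show ?thesis
    proof cases
      \<comment> \<open>The two lines leaving the node and its track suffice, so
        \<open>Node e (Suc n)\<close> is covered although its diagonal lies outside
        \<open>Z\<close>.\<close>
      case (1 k)
      then show ?thesis by (intro three[OF zZ, of "Line1 e k" "Line2 e k" "Track e"])
          (auto simp: Z_def touches_def)
    next
      case (2 k)
      then show ?thesis by (intro three[OF zZ, of "Node e (Suc k)" "Vertex (fst e)" "Point1 e k"])
          (auto simp: Z_def touches_def)
    next
      case (3 k)
      then show ?thesis by (intro three[OF zZ, of "Node e (Suc k)" Centre "Point2 e k"])
          (auto simp: Z_def touches_def)
    next
      case (4 k)
      then show ?thesis by (intro three[OF zZ, of "Line1 e k" "Marker (snd e)" "Diagonal e k"])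
          (auto simp: Z_def touches_def)
    next
      case (5 k)
      then show ?thesis by (intro three[OF zZ, of "Line2 e k" Axis "Diagonal e k"])
          (auto simp: Z_def touches_def)
    next
      case (6 k)
      then show ?thesis by (intro three[OF zZ, of "Point1 e k" "Point2 e k" "Node e k"])
          (auto simp: Z_def touches_def)
    qed
  qed
  moreover have "Point1 e n \<in> Z - F" "Line1 e n \<in> Z - F" using n unfolding Z_def by auto
  moreover have "config_adj r S (Vertex (fst e)) (Line1 e n)"
    "config_adj r S (Point1 e n) (Line1 e n)" "config_adj r S (Point1 e n) (Marker (snd e))"
    using e F by (auto simp: config_adj_def touches_def arc_def)
  ultimately show "\<exists>Z\<subseteq>config r S. finite Z \<and>
      (\<forall>z\<in>Z - ?A. 3 \<le> card {w \<in> Z. config_adj r S z w}) \<and>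
      (\<exists>p\<in>Z - F. \<exists>l\<in>Z - F. config_adj r S (Vertex (fst e)) l \<and>
        config_adj r S p l \<and> config_adj r S p (Marker (snd e)))"
    using Z by blast
qed

definition upper :: "'a rel \<Rightarrow> 'a \<Rightarrow> 'a config elem set" where
  "upper r b = (\<lambda>a. Base (Vertex a)) ` {a. (b, a) \<in> r}"

text \<open>Both copies of the marker over \<open>b\<close> see the same points. In a well-order
  this set identifies \<open>b\<close>, and the number of lines having it tells whether
  \<open>b\<close> is in \<open>S\<close>.\<close>

lemma linked_points_Marker:
  assumes "b \<in> Field r" and "i \<longrightarrow> b \<in> S"
  shows "linked_points (config_plane r S) (Base (Marker (b, i))) = upper r b"
proof
  have y: "Base (Marker (b, i)) \<in> lines (config_plane r S)"
    using assms by simp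
  show "linked_points (config_plane r S) (Base (Marker (b, i))) \<subseteq> upper r b"
    using linked_config_plane[OF _ _ y] unfolding linked_points_def upper_def arc_def by fastforce
  show "upper r b \<subseteq> linked_points (config_plane r S) (Base (Marker (b, i)))"
  proof
    fix x assume "x \<in> upper r b"
    then obtain a where a: "x = Base (Vertex a)" "(b, a) \<in> r" unfolding upper_def by blast
    then have "a \<in> Field r" by (simp add: FieldI2)
    then show "x \<in> linked_points (config_plane r S) (Base (Marker (b, i)))"
      using linked_arc[of r S "(a, b, i)"] a assms
      unfolding linked_points_def by (simp add: arc_def)
  qed
qed

text \<open>Makes markers recognisable by an isomorphism: a track has at most two linked points, and
  any other line that is not a marker at most one.\<close>

lemma infinite_linked_points:
  assumes inf: "infinite (linked_points (config_plane r S) y)"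
    and y: "y \<in> lines (config_plane r S)"
  obtains b i where "y = Base (Marker (b, i))" "b \<in> Field r" "i \<longrightarrow> b \<in> S"
proof -
  have "\<exists>b. y = Base (Marker b)"
  proof (rule ccontr)
    assume n: "\<nexists>b. y = Base (Marker b)"
    have "linked_points (config_plane r S) y \<subseteq>
      (case y of Base (Track e) \<Rightarrow> {Base (Vertex (fst e)), Base Centre} | _ \<Rightarrow> {Base Centre})"
      using linked_config_plane[OF _ _ y] n unfolding linked_points_def by fastforce
    moreover have "finite (case y of Base (Track e) \<Rightarrow> {Base (Vertex (fst e)), Base Centre}
      | _ \<Rightarrow> {Base Centre})"
      by (auto split: elem.split config.split)
    ultimately show False using inf finite_subset by blast
  qed
  then obtain b i where "y = Base (Marker (b, i))" by auto
  then show thesis using that[of b i] y by simp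
qed

section \<open>Rigidity of the well-order and recovery of the coded set\<close>

text \<open>At a least \<open>a\<close> with \<open>k a\<close> strictly below \<open>a\<close>, a
  second application puts \<open>k (k a)\<close> strictly below \<open>k a\<close>, against
  minimality.\<close>

lemma Well_order_strict_mono:
  assumes r: "Well_order r" and k: "\<And>a. a \<in> Field r \<Longrightarrow> k a \<in> Field r"
    and mono: "\<And>a b. (a, b) \<in> r \<Longrightarrow> a \<noteq> b \<Longrightarrow> (k a, k b) \<in> r \<and> k a \<noteq> k b"
    and a: "a \<in> Field r"
  shows "(a, k a) \<in> r"
proof -
  have wo: "wo_rel r" using r by (simp add: wo_rel_def)
  have "wf (r - Id)" using r by (simp add: well_order_on_def)
  then show ?thesis using a
  proof (induction a rule: wf_induct_rule)
    case (less a)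
    show ?case
    proof (rule ccontr)
      assume n: "(a, k a) \<notin> r"
      then have ka: "(k a, a) \<in> r" "k a \<noteq> a"
        using wo_rel.TOTALS[OF wo] wo_rel.REFL[OF wo] k less.prems
        by (blast, auto simp: refl_on_def)
      then have "(k (k a), k a) \<in> r" "k (k a) \<noteq> k a" using mono by blast+
      moreover have "(k a, k (k a)) \<in> r" using less.IH[of "k a"] ka k less.prems by blast
      ultimately show False using wo_rel.ANTISYM[OF wo] by (auto simp: antisym_def)
    qed
  qed
qed

locale infinite_cardinal =
  fixes r :: "'a rel"
  assumes Cinfinite: "Cinfinite r"
begin

lemma infinite_Field: "infinite (Field r)" and Card_order: "Card_order r"
  using Cinfinite by (auto simp: cinfinite_def)

lemma Well_order: "Well_order r"
  using Card_order by (simp add: card_order_on_def)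

lemma wo_rel: "wo_rel r"
  using Well_order by (simp add: wo_rel_def)

lemma finite_has_greatest:
  assumes "finite A" and "A \<noteq> {}" and "A \<subseteq> Field r"
  shows "\<exists>m\<in>A. \<forall>a\<in>A. (a, m) \<in> r"
  using assms
proof (induction rule: finite_ne_induct)
  case (singleton x)
  then show ?case using wo_rel.REFL[OF wo_rel] by (simp add: refl_on_def)
next
  case (insert x A)
  then obtain m where m: "m \<in> A" "\<forall>a\<in>A. (a, m) \<in> r" by auto
  show ?case
  proof (cases "(x, m) \<in> r")
    case True
    then show ?thesis using m by auto
  next
    case False
    then have "(m, x) \<in> r" "(x, x) \<in> r"
      using wo_rel.TOTALS[OF wo_rel] insert.prems m(1) by auto
    then show ?thesis using m(2) wo_rel.TRANS[OF wo_rel] by (auto dest: transD)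
  qed
qed

text \<open>A finite final segment would have a greatest element, but an infinite cardinal is a
  limit.\<close>

lemma infinite_upper:
  assumes b: "b \<in> Field r"
  shows "infinite (upper r b)"
proof
  let ?U = "{a. (b, a) \<in> r}"
  assume "finite (upper r b)"
  moreover have "inj_on (\<lambda>a. Base (Vertex a)) ?U" by (simp add: inj_on_def)
  ultimately have "finite ?U" unfolding upper_def by (rule finite_imageD)
  moreover have "b \<in> ?U" using wo_rel.REFL[OF wo_rel] b by (simp add: refl_on_def)
  moreover have "?U \<subseteq> Field r" by (auto intro: FieldI2)
  ultimately obtain m where m: "(b, m) \<in> r" "\<And>a. (b, a) \<in> r \<Longrightarrow> (a, m) \<in> r"
    using finite_has_greatest[of ?U] by auto
  have "m \<in> Field r" using m(1) by (rule FieldI2)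
  then obtain c where c: "m \<noteq> c" "(m, c) \<in> r"
    using infinite_Card_order_limit[OF Card_order infinite_Field] by blast
  then have "(b, c) \<in> r" using m(1) wo_rel.TRANS[OF wo_rel] by (blast dest: transD)
  then have "(c, m) \<in> r" by (rule m(2))
  then show False using c wo_rel.ANTISYM[OF wo_rel] by (auto dest: antisymD)
qed

lemma upper_subset_iff:
  assumes "b \<in> Field r" and "c \<in> Field r"
  shows "upper r b \<subseteq> upper r c \<longleftrightarrow> (c, b) \<in> r"
proof
  have "(b, b) \<in> r" using wo_rel.REFL[OF wo_rel] assms(1) by (simp add: refl_on_def)
  then show "(c, b) \<in> r" if "upper r b \<subseteq> upper r c"
    using that unfolding upper_def by auto
  show "upper r b \<subseteq> upper r c" if "(c, b) \<in> r"
    using that wo_rel.TRANS[OF wo_rel] unfolding upper_def by (auto dest: transD)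
qed

lemma upper_inject:
  assumes "b \<in> Field r" and "c \<in> Field r" and "upper r b = upper r c"
  shows "b = c"
  using assms upper_subset_iff wo_rel.ANTISYM[OF wo_rel] by (metis antisymD order_refl)

lemma upper_subset_points: "upper r b \<subseteq> points (config_plane r S)"
  unfolding upper_def by (auto intro: FieldI2)

text \<open>The image of the infinite set \<open>upper r b\<close> is the set of linked points of
  the image line, which must therefore be a marker again.\<close>

lemma image_upper:
  assumes f: "bij_betw f (points (config_plane r S)) (points (config_plane r S'))"
    and g: "bij_betw g (lines (config_plane r S)) (lines (config_plane r S'))"
    and i: "\<And>p l. p \<in> points (config_plane r S) \<Longrightarrow> l \<in> lines (config_plane r S) \<Longrightarrow>
      incident (config_plane r S') (f p) (g l) \<longleftrightarrow> incident (config_plane r S) p l"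
    and b: "b \<in> Field r" and "j \<longrightarrow> b \<in> S"
  shows "\<exists>c\<in>Field r. \<exists>j'. f ` upper r b = upper r c \<and> g (Base (Marker (b, j))) = Base (Marker (c, j')) \<and>
    (j' \<longrightarrow> c \<in> S')"
proof -
  let ?y = "Base (Marker (b, j))"
  have y: "?y \<in> lines (config_plane r S)" using assms by simp
  have gy: "g ?y \<in> lines (config_plane r S')" using g y by (rule bij_betw_apply)
  have eq: "linked_points (config_plane r S') (g ?y) = f ` upper r b"
    using linked_points_image[OF f g i y] linked_points_Marker[of b r j S] assms by simp
  have "inj_on f (upper r b)"
    using f upper_subset_points unfolding bij_betw_def by (meson inj_on_subset)
  then have "infinite (f ` upper r b)" using infinite_upper[OF b] finite_imageD by blast
  then obtain c j' where c: "g ?y = Base (Marker (c, j'))" "c \<in> Field r" "j' \<longrightarrow> c \<in> S'"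
    using infinite_linked_points[OF _ gy] eq by metis
  then have "f ` upper r b = upper r c" using eq linked_points_Marker[of c r j' S'] by simp
  then show ?thesis using c by blast
qed

text \<open>The isomorphism and its inverse induce strictly increasing maps \<open>k\<close> and
  \<open>k'\<close> of the well-order. Both move elements only upwards and
  \<open>k' (k b) = b\<close>, so \<open>k\<close> is the identity. Comparing the lines over each
  \<open>b\<close> then recovers membership.\<close>

lemma isomorphic_config_plane_subset:
  assumes "isomorphic (config_plane r S) (config_plane r S')" and S: "S \<subseteq> Field r"
  shows "S \<subseteq> S'"
proof -
  let ?P = "config_plane r S" and ?P' = "config_plane r S'"
  obtain f g where f: "bij_betw f (points ?P) (points ?P')" and g: "bij_betw g (lines ?P) (lines ?P')"
    and i: "\<And>p l. p \<in> points ?P \<Longrightarrow> l \<in> lines ?P \<Longrightarrow> incident ?P' (f p) (g l) \<longleftrightarrow> incident ?P p l"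
    using assms(1) unfolding isomorphic_def by auto
  let ?f = "inv_into (points ?P) f" and ?g = "inv_into (lines ?P) g"
  have i': "incident ?P (?f p) (?g l) \<longleftrightarrow> incident ?P' p l" if "p \<in> points ?P'" "l \<in> lines ?P'" for p l
    using i[of "?f p" "?g l"] that f g
    by (simp add: bij_betw_def inv_into_into f_inv_into_f del: config.plane_simps)
  note f' = bij_betw_inv_into[OF f] and g' = bij_betw_inv_into[OF g]
  \<comment> \<open>The copy with flag \<open>False\<close> is present for every \<open>b\<close>,
    in \<open>S\<close> or not.\<close>
  have "\<forall>b\<in>Field r. \<exists>c. c \<in> Field r \<and> f ` upper r b = upper r c"
    using image_upper[OF f g i, where j = False] by blast
  then obtain k where k: "\<And>b. b \<in> Field r \<Longrightarrow> k b \<in> Field r"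
    "\<And>b. b \<in> Field r \<Longrightarrow> f ` upper r b = upper r (k b)"
    by metis
  have "\<forall>b\<in>Field r. \<exists>c. c \<in> Field r \<and> ?f ` upper r b = upper r c"
    using image_upper[OF f' g' i', where j = False] by blast
  then obtain k' where k': "\<And>b. b \<in> Field r \<Longrightarrow> k' b \<in> Field r"
    "\<And>b. b \<in> Field r \<Longrightarrow> ?f ` upper r b = upper r (k' b)"
    by metis
  \<comment> \<open>Inclusion of upper sets reverses the order on both sides, so \<open>h\<close>
    preserves it. The map \<open>\<phi>\<close> is kept general to cover both \<open>f\<close> and
    its inverse.\<close>
  have mono: "(h a, h b) \<in> r \<and> h a \<noteq> h b"
    if h: "\<And>b. b \<in> Field r \<Longrightarrow> h b \<in> Field r" "\<And>b. b \<in> Field r \<Longrightarrow> \<phi> ` upper r b = upper r (h b)"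
      and inj: "inj_on \<phi> (points (config_plane r T))" and ab: "(a, b) \<in> r" "a \<noteq> b" for h \<phi> T a b
  proof -
    have F: "a \<in> Field r" "b \<in> Field r" using ab(1) by (auto intro: FieldI1 FieldI2)
    have "upper r b \<subseteq> upper r a" using upper_subset_iff F ab(1) by blast
    then have "upper r (h b) \<subseteq> upper r (h a)" using h(2) F by (metis image_mono)
    then have "(h a, h b) \<in> r" using upper_subset_iff h(1) F by blast
    moreover have "upper r a \<noteq> upper r b" using upper_inject F ab(2) by blast
    then have "\<phi> ` upper r a \<noteq> \<phi> ` upper r b"
      using inj_on_image_eq_iff[OF inj upper_subset_points upper_subset_points] by blast
    then have "h a \<noteq> h b" using h(2) F by metis
    ultimately show ?thesis ..
  qed
  have kge: "(b, k b) \<in> r" if "b \<in> Field r" for b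
    using Well_order_strict_mono[OF Well_order k(1) mono[OF k bij_betw_imp_inj_on[OF f]] that] .
  have k'ge: "(b, k' b) \<in> r" if "b \<in> Field r" for b
    using Well_order_strict_mono[OF Well_order k'(1) mono[OF k' bij_betw_imp_inj_on[OF f']] that] .
  have fix_upper: "f ` upper r b = upper r b" if b: "b \<in> Field r" for b
  proof -
    have "?f ` f ` upper r b = upper r b"
      using inv_into_image_cancel[OF bij_betw_imp_inj_on[OF f] upper_subset_points] .
    then have "upper r (k' (k b)) = upper r b" using k k' b by metis
    then have "k' (k b) = b" using upper_inject k(1) k'(1) b by blast
    then have "(k b, b) \<in> r" using k'ge[of "k b"] k(1) b by simp
    then have "k b = b" using kge[OF b] wo_rel.ANTISYM[OF wo_rel] by (meson antisymD)
    then show ?thesis using k(2) b by simp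
  qed
  show "S \<subseteq> S'"
  proof
    fix b assume bS: "b \<in> S"
    then have b: "b \<in> Field r" using S by blast
    have fixed: "\<exists>j'. g (Base (Marker (b, j))) = Base (Marker (b, j')) \<and> (j' \<longrightarrow> b \<in> S')" for j
    proof -
      obtain c j' where c: "c \<in> Field r" "f ` upper r b = upper r c"
        "g (Base (Marker (b, j))) = Base (Marker (c, j'))" "j' \<longrightarrow> c \<in> S'"
        using image_upper[OF f g i b, of j] bS by blast
      then have "c = b" using upper_inject b fix_upper by metis
      then show ?thesis using c by blast
    qed
    obtain j0 where j0: "g (Base (Marker (b, False))) = Base (Marker (b, j0))" "j0 \<longrightarrow> b \<in> S'"
      using fixed by blast
    obtain j1 where j1: "g (Base (Marker (b, True))) = Base (Marker (b, j1))" "j1 \<longrightarrow> b \<in> S'"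
      using fixed by blast
    \<comment> \<open>Two distinct lines over \<open>b\<close> have distinct images over
      \<open>b\<close>, so one image has flag \<open>True\<close>, which requires \<open>b\<close>
      in \<open>S'\<close>.\<close>
    have "Base (Marker (b, j)) \<in> lines ?P" for j using b bS by simp
    then have "g (Base (Marker (b, False))) \<noteq> g (Base (Marker (b, True)))"
      using bij_betw_imp_inj_on[OF g] by (simp add: inj_on_eq_iff del: config.plane_simps)
    then show "b \<in> S'" using j0 j1 by auto
  qed
qed

section \<open>Size and nondegeneracy of the coding plane\<close>

lemma card_of_config: "|config r S| \<le>o r"
proof -
  have le: "|A \<times> B| \<le>o r" if "|A| \<le>o r" "|B| \<le>o r" for A :: "'b set" and B :: "'c set"
    using card_of_Times_ordLeq_infinite_Field[OF infinite_Field that Card_order] .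
  have im: "|h ` A| \<le>o r" if "|A| \<le>o r" for h :: "'b \<Rightarrow> 'c" and A
    using card_of_image that ordLeq_transitive by blast
  have un: "|A \<union> B| \<le>o r" if "|A| \<le>o r" "|B| \<le>o r" for A B :: "'b set"
    using card_of_Un_ordLeq_infinite_Field[OF infinite_Field that Card_order] .
  have FF: "|Field r| \<le>o r" using card_of_Field_ordIso[OF Card_order] by (rule ordIso_imp_ordLeq)
  have nat: "|UNIV :: nat set| \<le>o r"
    using infinite_Field FF by (meson infinite_iff_card_of_nat ordLeq_transitive)
  have fin: "|A| \<le>o r" if "finite A" for A :: "'b set"
  proof -
    have "\<not> |Field r| \<le>o |A|" using card_of_ordLeq_finite that infinite_Field by blast
    then have "|A| \<le>o |Field r|" using ordLeq_total[OF card_of_Well_order card_of_Well_order] by blast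
    then show ?thesis using FF by (rule ordLeq_transitive)
  qed
  let ?E = "Field r \<times> Field r \<times> (UNIV :: bool set)"
  have E: "|?E| \<le>o r" by (intro le FF fin) simp
  have "x \<in> Vertex ` Field r \<union> Marker ` (Field r \<times> UNIV) \<union> {Centre, Axis} \<union> Track ` ?E \<union>
      case_prod Node ` (?E \<times> UNIV) \<union> case_prod Line1 ` (?E \<times> UNIV) \<union> case_prod Line2 ` (?E \<times> UNIV) \<union>
      case_prod Point1 ` (?E \<times> UNIV) \<union> case_prod Point2 ` (?E \<times> UNIV) \<union>
      case_prod Diagonal ` (?E \<times> UNIV)" (is "x \<in> ?U") if "x \<in> config r S" for x
  proof -
    have arc: "arc r S e \<Longrightarrow> e \<in> ?E" for e
      by (cases e) (auto simp: arc_def intro: FieldI1 FieldI2)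
    have im2: "h e n \<in> case_prod h ` (?E \<times> UNIV)" if "arc r S e" for h :: "'a arc \<Rightarrow> nat \<Rightarrow> 'a config" and e n
      using arc[OF that] by blast
    show ?thesis
      using that by (cases x) (auto intro: im2 arc dest: arc simp del: mem_Sigma_iff)
  qed
  then have "config r S \<subseteq> ?U" by blast
  moreover have "|?U| \<le>o r" by (intro un im le FF E nat fin) simp_all
  ultimately show ?thesis using card_of_mono1 ordLeq_transitive by blast
qed

text \<open>Any four vertices will do: a base line contains at most one vertex, and a new line
  contains no base points besides its parents, hence at most two vertices.\<close>

lemma nondegenerate_config_plane: "nondegenerate (config_plane r S)"
proof -
  obtain T where T: "finite T" "card T = 4" "T \<subseteq> Field r"
    using infinite_arbitrarily_large[OF infinite_Field] by blast
  define v where "v a = Base (Vertex a)" for a :: 'a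
  have "card (v ` T) = 4" using T(2) by (simp add: card_image inj_on_def v_def)
  moreover have "v ` T \<subseteq> points (config_plane r S)" using T(3) by (auto simp: v_def)
  moreover have "\<not> collinear_in (config_plane r S) U" if U: "U \<subseteq> v ` T" "card U = 3" for U
  proof
    assume "collinear_in (config_plane r S) U"
    then obtain l where l: "\<And>p. p \<in> U \<Longrightarrow> config.adj r S p l" unfolding collinear_in_def by auto
    have finU: "finite U" using U(2) by (metis card.infinite zero_neq_numeral)
    have "\<exists>p q. U \<subseteq> {p, q}"
    proof (cases l)
      case (Base m)
      have "p = q" if pq: "p \<in> U" "q \<in> U" for p q
      proof -
        obtain a b where ab: "p = v a" "q = v b" using pq U(1) by blast
        have "touches (Vertex a) m" "touches (Vertex b) m"
          using l[OF pq(1)] l[OF pq(2)] ab Base by (auto simp: v_def config_adj_def)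
        then have "a = b" unfolding touches_def by (cases m) auto
        then show ?thesis using ab by simp
      qed
      then show ?thesis by blast
    next
      case (New x y)
      have "p \<in> {x, y}" if "p \<in> U" for p
        using l[OF that] that U(1) New by (auto simp: v_def)
      then show ?thesis by blast
    qed
    then obtain p q where "U \<subseteq> {p, q}" by blast
    then have "card U \<le> card {p, q}" by (intro card_mono) simp_all
    also have "\<dots> \<le> 2" by (simp add: card_insert_if)
    finally show False using U(2) by simp
  qed
  ultimately show ?thesis unfolding nondegenerate_def by blast
qed

lemma ex_plane:
  "\<exists>P :: ('a, 'a) incidence_structure. isomorphic (config_plane r S) P \<and> projective_plane P \<and>
     nondegenerate P \<and> open_structure P \<and> |elements P| =o r"
proof -
  let ?P = "config_plane r S" and ?E = "{x. config.valid r S x}"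
  have "|?E| \<le>o r" by (rule config.card_of_valid[OF Cinfinite card_of_config])
  then have "|?E| \<le>o |Field r|"
    using card_of_Field_ordIso[OF Card_order] ordIso_symmetric ordLeq_ordIso_trans by blast
  then obtain h where h: "inj_on h ?E" "h ` ?E \<subseteq> Field r"
    unfolding card_of_ordLeq[symmetric] by blast
  have inj: "inj_on h (points ?P)" "inj_on h (lines ?P)"
    by (rule inj_on_subset[OF h(1)]; auto)+
  have iso: "isomorphic ?P (relabel h ?P)" using inj by (rule isomorphic_relabel)
  have sub: "points (relabel h ?P) \<subseteq> Field r" "lines (relabel h ?P) \<subseteq> Field r"
    using h(2) by (auto simp: relabel_def)
  have FF: "|Field r| =o r" using Card_order by (rule card_of_Field_ordIso)
  have le: "|A| \<le>o r" if "A \<subseteq> Field r" for A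
    using card_of_mono1[OF that] FF by (rule ordLeq_ordIso_trans)
  have upper: "|elements (relabel h ?P)| \<le>o r"
    unfolding elements_def
    by (rule card_of_Plus_ordLeq_infinite_Field[OF infinite_Field le[OF sub(1)] le[OF sub(2)] Card_order])
  \<comment> \<open>The vertices alone already give as many elements as the cardinal has.\<close>
  let ?v = "\<lambda>a. Inl (h (Base (Vertex a))) :: 'a + 'a"
  have "inj_on ?v (Field r)"
    by (rule inj_onI) (auto dest!: inj_onD[OF h(1)])
  moreover have "?v ` Field r \<subseteq> elements (relabel h ?P)"
    by (auto simp: elements_def relabel_def)
  ultimately have "|Field r| \<le>o |elements (relabel h ?P)|"
    by (rule card_of_ordLeqI[OF _ subsetD]) auto
  then have "r \<le>o |elements (relabel h ?P)|"
    using FF ordIso_symmetric ordIso_ordLeq_trans by blast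
  then have "|elements (relabel h ?P)| =o r" using upper by (simp add: ordIso_iff_ordLeq)
  then show ?thesis
    using iso projective_plane_isomorphic[OF iso config.projective_plane_plane]
      nondegenerate_isomorphic[OF iso nondegenerate_config_plane]
      open_structure_isomorphic[OF iso config.open_structure_plane] by blast
qed

end

section \<open>The family indexed by all subsets of the cardinal\<close>

theorem theorem1p5:
  fixes \<kappa> :: "'a rel"
  assumes "Cinfinite \<kappa>"
  shows "\<exists>F :: ('a, 'a) incidence_structure set.
           |F| =o ctwo ^c \<kappa> \<and>
           (\<forall>P\<in>F. projective_plane P \<and> nondegenerate P \<and> open_structure P \<and>
              |elements P| =o \<kappa>) \<and>
           (\<forall>P\<in>F. \<forall>P'\<in>F. P \<noteq> P' \<longrightarrow> \<not> isomorphic P P')"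
proof -
  interpret infinite_cardinal \<kappa> using assms by unfold_locales
  obtain P :: "'a set \<Rightarrow> ('a, 'a) incidence_structure" where
    P: "\<And>S. isomorphic (config_plane \<kappa> S) (P S)" "\<And>S. projective_plane (P S)"
      "\<And>S. nondegenerate (P S)" "\<And>S. open_structure (P S)" "\<And>S. |elements (P S)| =o \<kappa>"
    using ex_plane by metis
  have iso: "S = S'" if "isomorphic (P S) (P S')" "S \<subseteq> Field \<kappa>" "S' \<subseteq> Field \<kappa>" for S S'
  proof -
    have i: "isomorphic (config_plane \<kappa> S) (config_plane \<kappa> S')"
      using isomorphic_trans[OF isomorphic_trans[OF P(1) that(1)] isomorphic_sym[OF P(1)]] .
    show ?thesis
      using isomorphic_config_plane_subset[OF i] isomorphic_config_plane_subset[OF isomorphic_sym[OF i]]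
        that(2,3) by blast
  qed
  have refl: "isomorphic Q Q" for Q :: "('a, 'a) incidence_structure"
    unfolding isomorphic_def by (rule exI[of _ id], rule exI[of _ id]) simp
  let ?F = "P ` Pow (Field \<kappa>)"
  \<comment> \<open>Equal planes are isomorphic, so distinct subsets give not only non-isomorphic
    but distinct members of the family.\<close>
  have "inj_on P (Pow (Field \<kappa>))"
    using iso refl by (intro inj_onI) (metis PowD)
  then have "bij_betw P (Pow (Field \<kappa>)) ?F" by (rule inj_on_imp_bij_betw)
  then have "|Pow (Field \<kappa>)| =o |?F|" using card_of_ordIso by blast
  then have "|?F| =o |Func (Field \<kappa>) (UNIV :: bool set)|"
    using card_of_Pow_Func ordIso_symmetric ordIso_transitive by blast
  then have "|?F| =o ctwo ^c \<kappa>" by (simp add: cexp_def ctwo_def Field_card_of)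
  moreover have "\<forall>Q\<in>?F. \<forall>Q'\<in>?F. Q \<noteq> Q' \<longrightarrow> \<not> isomorphic Q Q'"
    using iso by blast
  ultimately show ?thesis using P by (intro exI[of _ ?F]) blast
qed

end
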